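(* Let $G$ be a group acting by isometries on a hyperbolic geodesic metric space $(S,d)$. Suppose that $H_1,\dots,H_k$ are convex cocompact subgroups of $G$ and $F\leqslant G$ contains a loxodromic WPD element. If $|F:(F\cap vH_iv^{-1})|=\infty$ for all $v\in G$ and $i=1,\dots,k$, then $F$ contains a loxodromic WPD element $f$ which is transverse to $H_i$ for each $i=1,\dots,k$.
   Context: All groups are countable and discrete. A geodesic metric space is hyperbolic if for some $\delta\ge0$ every side of every geodesic triangle lies in the $\delta$-neighborhood of the union of the other two. An element $g\in G$ is loxodromic if for $s\in S$ the map $\mathbb Z\to S$, $n\mapsto g^n(s)$, is a quasi-isometric embedding. A loxodromic $g$ is WPD if for all $s\in S$ and $\varepsilon\ge 0$ there is $N\in\mathbb N$ with $|\{u\in G\mid d(u(s),s)\le\varepsilon,\ d(ug^N(s),g^N(s))\le\varepsilon\}|<\infty$. A subgroup $H\le G$ is convex cocompact if it acts on $S$ metrically properly (for all $s\in S$, $R>0$ the set $\{h\in H\mid d(s,h(s))\le R\}$ is finite) and its orbits are quasi-convex (for $s\in S$ there is $\eta\ge0$ such that every geodesic with endpoints in $H(s)$ lies in the $\eta$-neighborhood of $H(s)$). Fix $s\in S$. An element $f\in G$ is transverse to a subset $Y\subseteq G$ if for every $E\ge0$ there exists $K\in\mathbb N$ such that for all $v\in G$, $|\{m\in\mathbb Z\mid d(f^m(s),vY(s))\le E\}|\le K$, where $vY(s)=\{vy(s)\mid y\in Y\}$ and $d(x,A)\le E$ means $d(x,a)\le E$ for some $a\in A$; this does not depend on $s$.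 *)

theory Defs
  imports "HOL-Analysis.Analysis" "HOL-Algebra.Algebra"
begin

definition geodesic_segment :: "'s::metric_space \<Rightarrow> 's \<Rightarrow> 's set \<Rightarrow> bool" where
  "geodesic_segment x y P \<longleftrightarrow>
     (\<exists>\<gamma>::real \<Rightarrow> 's. \<gamma> 0 = x \<and> \<gamma> (dist x y) = y \<and>
        (\<forall>t\<in>{0..dist x y}. \<forall>u\<in>{0..dist x y}. dist (\<gamma> t) (\<gamma> u) = \<bar>t - u\<bar>) \<and>
        P = \<gamma> ` {0..dist x y})"

definition geodesic_space :: "'s::metric_space itself \<Rightarrow> bool" where
  "geodesic_space _ \<longleftrightarrow> (\<forall>x y::'s. \<exists>P. geodesic_segment x y P)"

text \<open>Neighborhoods are closed, so that the radius \<open>0\<close> makes sense; as the radius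
  is existentially quantified at each use, this choice is immaterial.\<close>

definition neighborhood :: "real \<Rightarrow> 's::metric_space set \<Rightarrow> 's set" where
  "neighborhood r A = (\<Union>a\<in>A. cball a r)"

definition hyperbolic_space :: "'s::metric_space itself \<Rightarrow> bool" where
  "hyperbolic_space _ \<longleftrightarrow>
     (\<exists>\<delta>\<ge>0. \<forall>(x::'s) y z P Q R.
        geodesic_segment x y P \<and> geodesic_segment y z Q \<and> geodesic_segment z x R \<longrightarrow>
        P \<subseteq> neighborhood \<delta> (Q \<union> R) \<and>
        Q \<subseteq> neighborhood \<delta> (R \<union> P) \<and>
        R \<subseteq> neighborhood \<delta> (P \<union> Q))"

locale isometric_action = group_action G UNIV \<phi>
  for G (structure) and \<phi> :: "'g \<Rightarrow> 's::metric_space \<Rightarrow> 's" +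
  assumes isometry: "g \<in> carrier G \<Longrightarrow> dist (\<phi> g x) (\<phi> g y) = dist x y"

text \<open>The two metrics are explicit arguments because \<open>int\<close> is not an instance of
  \<open>metric_space\<close>.\<close>

definition quasi_isometric_embedding ::
    "('a \<Rightarrow> 'a \<Rightarrow> real) \<Rightarrow> ('b \<Rightarrow> 'b \<Rightarrow> real) \<Rightarrow> ('a \<Rightarrow> 'b) \<Rightarrow> bool" where
  "quasi_isometric_embedding d d' f \<longleftrightarrow>
     (\<exists>L\<ge>1. \<exists>c\<ge>0. \<forall>x y. d x y / L - c \<le> d' (f x) (f y) \<and> d' (f x) (f y) \<le> L * d x y + c)"

definition loxodromic ::
    "('g, 'b) monoid_scheme \<Rightarrow> ('g \<Rightarrow> 's::metric_space \<Rightarrow> 's) \<Rightarrow> 'g \<Rightarrow> bool" where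
  "loxodromic G \<phi> g \<longleftrightarrow> g \<in> carrier G \<and>
     (\<forall>s. quasi_isometric_embedding (\<lambda>m n. real_of_int \<bar>m - n\<bar>) dist
            (\<lambda>n::int. \<phi> (g [^]\<^bsub>G\<^esub> n) s))"

definition loxodromic_WPD ::
    "('g, 'b) monoid_scheme \<Rightarrow> ('g \<Rightarrow> 's::metric_space \<Rightarrow> 's) \<Rightarrow> 'g \<Rightarrow> bool" where
  "loxodromic_WPD G \<phi> g \<longleftrightarrow> loxodromic G \<phi> g \<and>
     (\<forall>s. \<forall>\<epsilon>\<ge>0. \<exists>N::nat.
        finite {u \<in> carrier G. dist (\<phi> u s) s \<le> \<epsilon> \<and>
                  dist (\<phi> (u \<otimes>\<^bsub>G\<^esub> g [^]\<^bsub>G\<^esub> N) s) (\<phi> (g [^]\<^bsub>G\<^esub> N) s) \<le> \<epsilon>})"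

definition metrically_proper :: "('g \<Rightarrow> 's::metric_space \<Rightarrow> 's) \<Rightarrow> 'g set \<Rightarrow> bool" where
  "metrically_proper \<phi> H \<longleftrightarrow> (\<forall>s. \<forall>R>0. finite {h \<in> H. dist s (\<phi> h s) \<le> R})"

definition quasiconvex :: "'s::metric_space set \<Rightarrow> bool" where
  "quasiconvex A \<longleftrightarrow>
     (\<exists>\<eta>\<ge>0. \<forall>x\<in>A. \<forall>y\<in>A. \<forall>P. geodesic_segment x y P \<longrightarrow> P \<subseteq> neighborhood \<eta> A)"

definition convex_cocompact ::
    "('g, 'b) monoid_scheme \<Rightarrow> ('g \<Rightarrow> 's::metric_space \<Rightarrow> 's) \<Rightarrow> 'g set \<Rightarrow> bool" where
  "convex_cocompact G \<phi> H \<longleftrightarrow>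
     subgroup H G \<and> metrically_proper \<phi> H \<and> (\<forall>s. quasiconvex ((\<lambda>h. \<phi> h s) ` H))"

definition transverse ::
    "('g, 'b) monoid_scheme \<Rightarrow> ('g \<Rightarrow> 's::metric_space \<Rightarrow> 's) \<Rightarrow> 's \<Rightarrow> 'g \<Rightarrow> 'g set \<Rightarrow> bool" where
  "transverse G \<phi> s f Y \<longleftrightarrow>
     (\<forall>E\<ge>0. \<exists>K::nat. \<forall>v\<in>carrier G.
        finite {m::int. \<exists>y\<in>Y. dist (\<phi> (f [^]\<^bsub>G\<^esub> m) s) (\<phi> (v \<otimes>\<^bsub>G\<^esub> y) s) \<le> E} \<and>
        card {m::int. \<exists>y\<in>Y. dist (\<phi> (f [^]\<^bsub>G\<^esub> m) s) (\<phi> (v \<otimes>\<^bsub>G\<^esub> y) s) \<le> E} \<le> K)"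

text \<open>The basepoint is immaterial.\<close>

lemma (in isometric_action) transverse_basepoint:
  assumes f: "f \<in> carrier G" and Y: "Y \<subseteq> carrier G" and tr: "transverse G \<phi> s f Y"
  shows "transverse G \<phi> s' f Y"
  unfolding transverse_def
proof (intro allI impI)
  interpret group G by (rule group_hom.axioms(1)[OF group_hom])
  fix E :: real assume "E \<ge> 0"
  let ?A = "\<lambda>s E v. {m::int. \<exists>y\<in>Y. dist (\<phi> (f [^] m) s) (\<phi> (v \<otimes> y) s) \<le> E}"
  have "E + 2 * dist s s' \<ge> 0" using \<open>E \<ge> 0\<close> by simp
  then obtain K where K: "\<forall>v\<in>carrier G. finite (?A s (E + 2 * dist s s') v) \<and>
      card (?A s (E + 2 * dist s s') v) \<le> K"
    using tr unfolding transverse_def by (elim allE impE exE) assumption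
  have "finite (?A s' E v) \<and> card (?A s' E v) \<le> K" if v: "v \<in> carrier G" for v
  proof -
    have "dist (\<phi> a s) (\<phi> b s) \<le> dist (\<phi> a s') (\<phi> b s') + 2 * dist s s'"
      if "a \<in> carrier G" "b \<in> carrier G" for a b
    proof -
      have "dist (\<phi> a s) (\<phi> a s') = dist s s'" "dist (\<phi> b s) (\<phi> b s') = dist s s'"
        using that isometry by auto
      then show ?thesis
        using dist_triangle[of "\<phi> a s" "\<phi> b s" "\<phi> a s'"]
          dist_triangle[of "\<phi> a s'" "\<phi> b s" "\<phi> b s'"]
        by (simp add: dist_commute)
    qed
    note le = this
    have sub: "?A s' E v \<subseteq> ?A s (E + 2 * dist s s') v"
    proof safe
      fix m :: int and y assume y: "y \<in> Y" and d: "dist (\<phi> (f [^] m) s') (\<phi> (v \<otimes> y) s') \<le> E"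
      have "f [^] m \<in> carrier G" "v \<otimes> y \<in> carrier G"
        using f Y v y by auto
      from le[OF this] d y show "\<exists>y\<in>Y. dist (\<phi> (f [^] m) s) (\<phi> (v \<otimes> y) s) \<le> E + 2 * dist s s'"
        by (intro bexI[of _ y]) linarith+
    qed
    have fin: "finite (?A s (E + 2 * dist s s') v)" and le_K: "card (?A s (E + 2 * dist s s') v) \<le> K"
      using K v by simp_all
    show ?thesis
      using finite_subset[OF sub fin] order_trans[OF card_mono[OF fin sub] le_K] by (rule conjI)
  qed
  then show "\<exists>K. \<forall>v\<in>carrier G. finite (?A s' E v) \<and> card (?A s' E v) \<le> K"
    by blast
qed

end

theory Submission
  imports Defs "HOL-Real_Asymp.Real_Asymp"
begin

text \<open>Write \<open>d\<close> for the metric and \<open>g\<close> for a loxodromic WPD element of \<open>F\<close>.  Transversality of a loxodromic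
WPD element \<open>f\<close> to a convex cocompact subgroup \<open>H\<close> follows from an algebraic condition: no positive
power of \<open>f\<close> lies in a conjugate of \<open>H\<close> (\<open>no_conjugate_power_imp_transverse\<close>).  The reason is a
local finiteness property of the cosets of \<open>H\<close>: if \<open>N\<close> is large enough for the WPD condition, then only
finitely many cosets \<open>vH\<close> have a translate \<open>vH(s)\<close> that passes near both \<open>s\<close> and \<open>f\<^sup>N(s)\<close>
(\<open>coset_near_finite\<close>).  A translate \<open>vH(s)\<close> that meets the orbit of \<open>f\<close> in two distant places
follows it in between by quasiconvexity, so by the pigeonhole principle two of the cosets
\<open>f\<^sup>-\<^sup>m vH\<close> coincide, and a power of \<open>f\<close> stabilizes \<open>vH\<close>.

It remains to find \<open>f\<close> in \<open>F\<close> without powers in conjugates of the \<open>H\<^sub>i\<close>.  If finitely many cosets of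
\<open>\<langle>g\<rangle>\<close> cover \<open>F\<close>, then \<open>f = g\<close> works, since otherwise a conjugate of some \<open>H\<^sub>i\<close> would meet \<open>F\<close>
in a subgroup of finite index.  In the other case \<open>f\<close> has the form \<open>g\<^sup>a x g\<^sup>b\<close> with \<open>x \<in> F\<close> and large \<open>a\<close>, \<open>b\<close>.  If the ray
\<open>x g\<^sup>n(s)\<close> does not stay close to the ray \<open>g\<^sup>-\<^sup>m(s)\<close>, then the broken path with vertices
\<open>f\<^sup>i(s)\<close> is quasigeodesic and passes near \<open>s\<close> and \<open>g\<^sup>N(s)\<close>, with constants that depend on \<open>g\<close> alone and
not on \<open>x\<close> (\<open>concatenation_straight\<close>).  This uniformity carries the argument: it makes \<open>f\<close> inherit
the WPD property from the single number \<open>N\<close> (\<open>loxodromic_WPD_criterion\<close>), and it allows \<open>N\<close>, and with it the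
finite sets \<open>C\<^sub>i\<close> of representatives of the cosets of \<open>H\<^sub>i\<close> near both \<open>s\<close> and \<open>g\<^sup>N(s)\<close>, to be fixed before \<open>x\<close> is
chosen.  Now suppose that a power of \<open>f\<close> stabilizes \<open>vH\<^sub>i\<close>.  It stabilizes \<open>f\<^sup>-\<^sup>1vH\<^sub>i\<close> as well, both
translates follow the whole orbit of \<open>f\<close>, so both cosets are represented in \<open>C\<^sub>i\<close>, and \<open>f\<close> lies in one of
the finitely many sets \<open>c H\<^sub>i c'\<^sup>-\<^sup>1\<close> with \<open>c, c' \<in> C\<^sub>i\<close>.

So \<open>x\<close> has to avoid these finitely many cosets of conjugates of the \<open>H\<^sub>i\<close>, and finitely many cosets of
\<open>\<langle>g\<rangle>\<close> that contain all elements for which the two rays are parallel (\<open>parallel_translates_finite\<close>).  None of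
these subgroups meets \<open>F\<close> in a subgroup of finite index, so such an \<open>x\<close> exists by B. H. Neumann's covering
lemma (\<open>neumann_coset_covering\<close>).  The exponents \<open>a\<close> and \<open>b\<close> are then chosen so that \<open>f\<close> avoids the sets
\<open>c H\<^sub>i c'\<^sup>-\<^sup>1\<close> along with \<open>x\<close> (\<open>ex_powers_avoiding\<close>).

All geometry is done with Gromov products and the four-point inequality: "\<open>p\<close> lies near a geodesic
from \<open>x\<close> to \<open>y\<close>" is expressed by a bound on the Gromov product of \<open>x\<close> and \<open>y\<close> at \<open>p\<close>.\<close>

section \<open>Gromov products and the four-point inequality\<close>

definition gromov_product :: "'s::metric_space \<Rightarrow> 's \<Rightarrow> 's \<Rightarrow> real" where
  "gromov_product p x y = (dist p x + dist p y - dist x y) / 2"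

lemma gromov_product_commute: "gromov_product p x y = gromov_product p y x"
  by (simp add: gromov_product_def dist_commute)

lemma gromov_product_nonneg: "0 \<le> gromov_product p x y"
  unfolding gromov_product_def using dist_triangle3[of x y p] by simp

lemma gromov_product_le_dist: "gromov_product p x y \<le> dist p x"
  unfolding gromov_product_def using dist_triangle[of p y x] by (simp add: dist_commute)

lemma gromov_product_add_swap: "gromov_product p x y + gromov_product x p y = dist p x"
  unfolding gromov_product_def by (simp add: dist_commute field_simps)

lemma gromov_product_ge_dist: "dist p x - dist x y \<le> gromov_product p x y"
  unfolding gromov_product_def using dist_triangle[of p x y] by (simp add: dist_commute field_simps)

lemma gromov_product_perturb:
  "gromov_product p x y \<le> gromov_product p' x' y' + dist p p' + dist x x' + dist y y'"
proof -
  have "dist p x \<le> dist p p' + dist p' x' + dist x x'"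
    using dist_triangle[of p x p'] dist_triangle[of p' x x'] by (simp add: dist_commute)
  moreover have "dist p y \<le> dist p p' + dist p' y' + dist y y'"
    using dist_triangle[of p y p'] dist_triangle[of p' y y'] by (simp add: dist_commute)
  moreover have "dist x' y' \<le> dist x x' + dist x y + dist y y'"
    using dist_triangle[of x' y' x] dist_triangle[of x y' y] by (simp add: dist_commute)
  ultimately show ?thesis unfolding gromov_product_def by (simp add: field_simps)
qed

lemma geodesic_segment_endpoints:
  assumes "geodesic_segment x y P"
  shows "x \<in> P" "y \<in> P"
proof -
  obtain \<gamma> where "\<gamma> 0 = x" "\<gamma> (dist x y) = y" "P = \<gamma> ` {0..dist x y}"
    using assms unfolding geodesic_segment_def by blast
  moreover have "0 \<in> {0..dist x y}" "dist x y \<in> {0..dist x y}" by simp_all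
  ultimately show "x \<in> P" "y \<in> P" by (metis imageI)+
qed

lemma geodesic_segment_dist:
  assumes "geodesic_segment x y P" "z \<in> P"
  shows "dist x z + dist z y = dist x y"
proof -
  obtain \<gamma> where \<gamma>: "\<gamma> 0 = x" "\<gamma> (dist x y) = y" "P = \<gamma> ` {0..dist x y}"
    and iso: "\<forall>t\<in>{0..dist x y}. \<forall>u\<in>{0..dist x y}. dist (\<gamma> t) (\<gamma> u) = \<bar>t - u\<bar>"
    using assms(1) unfolding geodesic_segment_def by blast
  obtain t where t: "t \<in> {0..dist x y}" "z = \<gamma> t" using assms(2) \<gamma>(3) by blast
  have "dist (\<gamma> 0) (\<gamma> t) = \<bar>0 - t\<bar>" "dist (\<gamma> t) (\<gamma> (dist x y)) = \<bar>t - dist x y\<bar>"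
    using iso t(1) by simp_all
  then show ?thesis using t \<gamma>(1,2) by simp
qed

lemma geodesic_segment_point_at:
  assumes "geodesic_segment x y P" "0 \<le> t" "t \<le> dist x y"
  shows "\<exists>z\<in>P. dist x z = t"
proof -
  obtain \<gamma> where \<gamma>: "\<gamma> 0 = x" "P = \<gamma> ` {0..dist x y}"
    and iso: "\<forall>t\<in>{0..dist x y}. \<forall>u\<in>{0..dist x y}. dist (\<gamma> t) (\<gamma> u) = \<bar>t - u\<bar>"
    using assms(1) unfolding geodesic_segment_def by blast
  have "dist (\<gamma> 0) (\<gamma> t) = \<bar>0 - t\<bar>" using iso assms(2,3) by simp
  then show ?thesis using \<gamma> assms(2,3) by (intro bexI[of _ "\<gamma> t"]) auto
qed

lemma geodesic_segment_compact:
  assumes "geodesic_segment x y P"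
  shows "compact P"
proof -
  obtain \<gamma> where \<gamma>: "P = \<gamma> ` {0..dist x y}"
    and iso: "\<forall>t\<in>{0..dist x y}. \<forall>u\<in>{0..dist x y}. dist (\<gamma> t) (\<gamma> u) = \<bar>t - u\<bar>"
    using assms(1) unfolding geodesic_segment_def by blast
  have "continuous_on {0..dist x y} \<gamma>"
  proof (rule continuous_onI)
    fix t e :: real assume "0 < e" "t \<in> {0..dist x y}"
    then show "\<exists>d>0. \<forall>u\<in>{0..dist x y}. dist u t < d \<longrightarrow> dist (\<gamma> u) (\<gamma> t) \<le> e"
      using iso by (intro exI[of _ e]) (simp add: dist_real_def)
  qed
  then show ?thesis using \<gamma> compact_continuous_image by blast
qed

lemma geodesic_segment_reverse:
  assumes "geodesic_segment x y P"
  shows "geodesic_segment y x P"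
proof -
  obtain \<gamma> where \<gamma>: "\<gamma> 0 = x" "\<gamma> (dist x y) = y" "P = \<gamma> ` {0..dist x y}"
    and iso: "\<forall>t\<in>{0..dist x y}. \<forall>u\<in>{0..dist x y}. dist (\<gamma> t) (\<gamma> u) = \<bar>t - u\<bar>"
    using assms(1) unfolding geodesic_segment_def by blast
  let ?\<rho> = "\<lambda>t. \<gamma> (dist x y - t)"
  have "(\<lambda>t. dist x y - t) ` {0..dist x y} = {0..dist x y}"
    by (simp add: image_diff_atLeastAtMost)
  then have "P = ?\<rho> ` {0..dist x y}"
    using \<gamma>(3) by (metis image_image)
  moreover have "\<forall>t\<in>{0..dist x y}. \<forall>u\<in>{0..dist x y}. dist (?\<rho> t) (?\<rho> u) = \<bar>t - u\<bar>"
  proof (intro ballI)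
    fix t u assume "t \<in> {0..dist x y}" "u \<in> {0..dist x y}"
    then show "dist (?\<rho> t) (?\<rho> u) = \<bar>t - u\<bar>"
      using iso[rule_format, of "dist x y - t" "dist x y - u"] by simp
  qed
  ultimately show ?thesis unfolding geodesic_segment_def
    using \<gamma>(1,2) by (intro exI[of _ ?\<rho>]) (simp add: dist_commute)
qed

lemma compact_infdist_attained:
  assumes "compact A" "A \<noteq> {}"
  shows "\<exists>a\<in>A. dist p a = infdist p A"
proof -
  obtain a where "a \<in> A" "\<forall>b\<in>A. dist p a \<le> dist p b"
    using continuous_attains_inf[OF assms continuous_on_dist[OF continuous_on_const continuous_on_id], of p]
    by blast
  then have "dist p a \<le> infdist p A"
    using assms(2) by (auto simp: infdist_def intro!: cINF_greatest)
  with \<open>a \<in> A\<close> infdist_le[of a A p] show ?thesis by force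
qed

text \<open>The side \<open>P\<close> is covered by the neighborhoods of the other two sides, so by continuity it
has a point \<open>p\<close> that is \<open>\<delta>\<close>-close to both.  Going from \<open>w\<close> to \<open>x\<close> or to \<open>y\<close> by way of \<open>p\<close> is then a detour
of at most \<open>2\<delta>\<close>.\<close>

lemma geodesic_point_near_gromov_product:
  fixes w x y :: "'s::metric_space"
  assumes PQR: "geodesic_segment x y P" "geodesic_segment w x Q" "geodesic_segment w y R"
    and thin: "P \<subseteq> neighborhood \<delta> (Q \<union> R)"
  shows "\<exists>p\<in>P. dist w p \<le> gromov_product w x y + 2 * \<delta>"
proof -
  obtain \<gamma> where \<gamma>: "\<gamma> 0 = x" "\<gamma> (dist x y) = y" "P = \<gamma> ` {0..dist x y}"
    and iso: "\<forall>t\<in>{0..dist x y}. \<forall>u\<in>{0..dist x y}. dist (\<gamma> t) (\<gamma> u) = \<bar>t - u\<bar>"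
    using PQR(1) unfolding geodesic_segment_def by blast
  have cont: "continuous_on {0..dist x y} \<gamma>"
  proof (rule continuous_onI)
    fix t e :: real assume "0 < e" "t \<in> {0..dist x y}"
    then show "\<exists>d>0. \<forall>u\<in>{0..dist x y}. dist u t < d \<longrightarrow> dist (\<gamma> u) (\<gamma> t) \<le> e"
      using iso by (intro exI[of _ e]) (simp add: dist_real_def)
  qed
  have ne: "Q \<noteq> {}" "R \<noteq> {}"
    using geodesic_segment_endpoints PQR(2,3) by blast+
  \<comment> \<open>Where the distances to the two sides agree, both are at most \<open>\<delta>\<close>, because one of them is.\<close>
  let ?f = "\<lambda>t. infdist (\<gamma> t) Q - infdist (\<gamma> t) R"
  have "?f 0 \<le> 0" using \<gamma>(1) geodesic_segment_endpoints(2)[OF PQR(2)]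
    by (simp add: infdist_zero infdist_nonneg)
  moreover have "0 \<le> ?f (dist x y)" using \<gamma>(2) geodesic_segment_endpoints(2)[OF PQR(3)]
    by (simp add: infdist_zero infdist_nonneg)
  moreover have "continuous_on {0..dist x y} ?f"
    using cont ne by (intro continuous_intros)
  ultimately obtain t where t: "0 \<le> t" "t \<le> dist x y" "?f t = 0"
    using IVT'[of ?f 0 0 "dist x y"] by auto
  let ?p = "\<gamma> t"
  have p: "?p \<in> P" using t \<gamma>(3) by auto
  obtain z where z: "z \<in> Q \<union> R" "dist z ?p \<le> \<delta>"
    using subsetD[OF thin p] unfolding neighborhood_def by auto
  have "infdist ?p Q \<le> \<delta>" "infdist ?p R \<le> \<delta>"
    using z t(3) infdist_le[of z Q ?p] infdist_le[of z R ?p] by (auto simp: dist_commute)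
  moreover obtain a b where "a \<in> Q" "b \<in> R" "dist ?p a = infdist ?p Q" "dist ?p b = infdist ?p R"
    using compact_infdist_attained[OF geodesic_segment_compact[OF PQR(2)] ne(1), of ?p]
      compact_infdist_attained[OF geodesic_segment_compact[OF PQR(3)] ne(2), of ?p] by blast
  ultimately have ab: "a \<in> Q" "b \<in> R" "dist ?p a \<le> \<delta>" "dist ?p b \<le> \<delta>"
    by simp_all
  have "dist w a + dist a x = dist w x" "dist w b + dist b y = dist w y"
    "dist x ?p + dist ?p y = dist x y"
    using geodesic_segment_dist PQR ab p by blast+
  moreover have "dist w ?p \<le> dist w a + dist ?p a" "dist w ?p \<le> dist w b + dist ?p b"
    "dist x ?p \<le> dist a x + dist ?p a" "dist ?p y \<le> dist ?p b + dist b y"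
    using dist_triangle[of w ?p a] dist_triangle[of w ?p b] dist_triangle[of x ?p a] dist_triangle[of ?p y b]
    by (simp_all add: dist_commute)
  ultimately have "dist w ?p \<le> gromov_product w x y + 2 * \<delta>"
    unfolding gromov_product_def using ab(3,4) by (simp add: field_simps)
  with p show ?thesis by blast
qed

lemma gromov_product_le_geodesic:
  assumes "geodesic_segment x y P" "p \<in> P"
  shows "gromov_product w x y \<le> dist w p"
  using geodesic_segment_dist[OF assms] dist_triangle[of w x p] dist_triangle[of w y p]
  unfolding gromov_product_def by (simp add: dist_commute field_simps)

text \<open>Gromov's definition of hyperbolicity.  The constant may differ from the thinness constant of geodesic triangles.\<close>

definition four_point_condition :: "real \<Rightarrow> 's::metric_space itself \<Rightarrow> bool" where
  "four_point_condition \<delta> _ \<longleftrightarrow> 0 \<le> \<delta> \<and> (\<forall>w x y z :: 's.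
     min (gromov_product w x y) (gromov_product w y z) \<le> gromov_product w x z + \<delta>)"

locale gromov_hyperbolic =
  fixes \<delta> :: real and S :: "'s::metric_space itself"
  assumes four_point: "four_point_condition \<delta> S"
begin

lemma delta_nonneg: "0 \<le> \<delta>"
  using four_point unfolding four_point_condition_def by blast

lemma gromov_ineq:
  fixes w x y z :: 's
  shows "min (gromov_product w x y) (gromov_product w y z) \<le> gromov_product w x z + \<delta>"
  using four_point unfolding four_point_condition_def by blast

end

text \<open>In a geodesic triangle the Gromov product at \<open>w\<close> is, up to a bounded error, the distance from \<open>w\<close>
to the opposite side.  A point of \<open>[x, z]\<close> that realizes it is \<open>\<delta>\<close>-close to \<open>[x, y]\<close> or to \<open>[y, z]\<close>.\<close>

lemma hyperbolic_space_imp_four_point: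
  assumes "geodesic_space TYPE('s::metric_space)" "hyperbolic_space TYPE('s)"
  shows "\<exists>\<delta>. four_point_condition \<delta> TYPE('s)"
proof -
  obtain \<delta> where \<delta>: "\<delta> \<ge> 0" and thin: "\<And>(x::'s) y z P Q R.
        geodesic_segment x y P \<Longrightarrow> geodesic_segment y z Q \<Longrightarrow> geodesic_segment z x R \<Longrightarrow>
        P \<subseteq> neighborhood \<delta> (Q \<union> R)"
    using assms(2) unfolding hyperbolic_space_def by meson
  have geo: "\<exists>P. geodesic_segment x y P" for x y :: 's
    using assms(1) unfolding geodesic_space_def by blast
  have "min (gromov_product w x y) (gromov_product w y z) \<le> gromov_product w x z + 3 * \<delta>"
    for w x y z :: 's
  proof -
    obtain P Q R U V where seg: "geodesic_segment x z P" "geodesic_segment w x Q"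
      "geodesic_segment w z R" "geodesic_segment x y U" "geodesic_segment y z V"
      using geo by meson
    have "P \<subseteq> neighborhood \<delta> (R \<union> Q)"
      using thin[OF seg(1) geodesic_segment_reverse[OF seg(3)] seg(2)] .
    then obtain p where p: "p \<in> P" "dist w p \<le> gromov_product w x z + 2 * \<delta>"
      using geodesic_point_near_gromov_product[OF seg(1-3), of \<delta>] by (auto simp: Un_commute)
    have PVU: "P \<subseteq> neighborhood \<delta> (V \<union> U)"
      using thin[OF seg(1) geodesic_segment_reverse[OF seg(5)] geodesic_segment_reverse[OF seg(4)]] .
    then obtain q where q: "q \<in> V \<union> U" "dist q p \<le> \<delta>"
      using subsetD[OF PVU p(1)] unfolding neighborhood_def by auto
    have "min (gromov_product w x y) (gromov_product w y z) \<le> dist w q"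
      using q(1) gromov_product_le_geodesic[OF seg(4)] gromov_product_le_geodesic[OF seg(5)]
      by (auto simp: min_le_iff_disj)
    also have "\<dots> \<le> dist w p + \<delta>"
      using q(2) dist_triangle[of w q p] by (simp add: dist_commute)
    finally show ?thesis using p(2) by simp
  qed
  then have "four_point_condition (3 * \<delta>) TYPE('s)"
    using \<delta> unfolding four_point_condition_def by simp
  then show ?thesis by blast
qed

context gromov_hyperbolic
begin

text \<open>If \<open>p\<close> is near a geodesic from \<open>x\<close> to \<open>y\<close>, and \<open>z\<close> lies in the same direction from \<open>p\<close> as \<open>y\<close>, then \<open>y\<close> may be
replaced by \<open>z\<close>.  Each replacement costs \<open>\<delta>\<close>.\<close>

lemma gromov_product_replace:
  fixes p x y z :: 's
  assumes "gromov_product p x y \<le> D" "D + \<delta> < gromov_product p y z"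
  shows "gromov_product p x z \<le> D + \<delta>"
  using assms gromov_ineq[of p x z y] by (simp add: gromov_product_commute min_le_iff_disj)

lemma gromov_product_replace_near:
  fixes p x y z :: 's
  assumes "gromov_product p x y \<le> D" "D + \<delta> + dist y z < dist p y"
  shows "gromov_product p x z \<le> D + \<delta>"
  using gromov_product_replace[OF assms(1)] gromov_product_ge_dist[of p y z] assms(2) by simp

text \<open>Up to a bounded error, two points near the same geodesic are as far apart as their distances from its
origin differ.\<close>

lemma dist_le_if_near_same_geodesic:
  fixes p q x y :: 's
  assumes "gromov_product p x y \<le> D" "gromov_product q x y \<le> D"
  shows "dist p q \<le> \<bar>dist x p - dist x q\<bar> + 2 * D + 2 * \<delta>"
proof -
  have "dist x p - D \<le> gromov_product x p y"
    using gromov_product_add_swap[of x p y] assms(1) by (simp add: dist_commute)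
  moreover have "dist x q - D \<le> gromov_product x q y"
    using gromov_product_add_swap[of x q y] assms(2) by (simp add: dist_commute)
  ultimately have "min (dist x p) (dist x q) - D \<le> gromov_product x p q + \<delta>"
    using gromov_ineq[of x p y q] by (simp add: gromov_product_commute min_def split: if_splits)
  then show ?thesis unfolding gromov_product_def by (simp add: min_def abs_if field_simps split: if_splits)
qed

end

section \<open>Sequences with a transitive shift\<close>

text \<open>The orbits \<open>i \<mapsto> g\<^sup>i(p)\<close> of an isometry \<open>g\<close> have this property, and it is all that the
passage from local to global estimates uses of them.\<close>

definition homogeneous :: "(int \<Rightarrow> 's::metric_space) \<Rightarrow> bool" where
  "homogeneous Z \<longleftrightarrow> (\<forall>i j k. dist (Z (i + k)) (Z (j + k)) = dist (Z i) (Z j))"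

text \<open>Bounded backtracking: \<open>Z j\<close> lies near every geodesic from an earlier to a later term.\<close>

definition straight :: "real \<Rightarrow> (int \<Rightarrow> 's::metric_space) \<Rightarrow> bool" where
  "straight D Z \<longleftrightarrow> (\<forall>i j k. i \<le> j \<longrightarrow> j \<le> k \<longrightarrow> gromov_product (Z j) (Z i) (Z k) \<le> D)"

lemma homogeneous_dist:
  assumes "homogeneous Z"
  shows "dist (Z (i + k)) (Z (j + k)) = dist (Z i) (Z j)"
  using assms unfolding homogeneous_def by blast

lemma homogeneous_dist_0:
  assumes "homogeneous Z"
  shows "dist (Z i) (Z j) = dist (Z 0) (Z (j - i))"
  using homogeneous_dist[OF assms, of 0 i "j - i"] by simp

lemma homogeneous_dist_abs:
  assumes "homogeneous Z"
  shows "dist (Z i) (Z j) = dist (Z 0) (Z \<bar>j - i\<bar>)"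
  using homogeneous_dist_0[OF assms, of i j] homogeneous_dist_0[OF assms, of j i]
  by (simp add: abs_if dist_commute)

lemma homogeneous_gromov_product:
  assumes "homogeneous Z"
  shows "gromov_product (Z (j + l)) (Z (i + l)) (Z (k + l)) = gromov_product (Z j) (Z i) (Z k)"
  using homogeneous_dist[OF assms] unfolding gromov_product_def by simp

lemma homogeneous_reverse: "homogeneous Z \<Longrightarrow> homogeneous (\<lambda>i. Z (- i))"
  unfolding homogeneous_def by (metis minus_add_distrib)

lemma homogeneous_dilate: "homogeneous Z \<Longrightarrow> homogeneous (\<lambda>i. Z (m * i))"
  unfolding homogeneous_def by (simp add: distrib_left)

lemma straight_iff:
  assumes "homogeneous Z"
  shows "straight D Z \<longleftrightarrow> (\<forall>m n::nat. gromov_product (Z 0) (Z (- int m)) (Z (int n)) \<le> D)"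
proof
  show "straight D Z \<Longrightarrow> \<forall>m n::nat. gromov_product (Z 0) (Z (- int m)) (Z (int n)) \<le> D"
    unfolding straight_def by simp
next
  assume *: "\<forall>m n::nat. gromov_product (Z 0) (Z (- int m)) (Z (int n)) \<le> D"
  show "straight D Z" unfolding straight_def
  proof (intro allI impI)
    fix i j k :: int assume "i \<le> j" "j \<le> k"
    then have "gromov_product (Z 0) (Z (i - j)) (Z (k - j)) \<le> D"
      using *[rule_format, of "nat (j - i)" "nat (k - j)"] by simp
    then show "gromov_product (Z j) (Z i) (Z k) \<le> D"
      using homogeneous_gromov_product[OF assms, of 0 j "i - j" "k - j"] by simp
  qed
qed

lemma straight_nonneg: "straight D Z \<Longrightarrow> 0 \<le> D"
proof -
  assume "straight D Z"
  then have "gromov_product (Z 0) (Z 0) (Z 0) \<le> D" unfolding straight_def by simp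
  then show "0 \<le> D" using gromov_product_nonneg[of "Z 0" "Z 0" "Z 0"] by linarith
qed


context gromov_hyperbolic
begin

text \<open>A broken path whose segments are long compared with the backtracking at its vertices is a
quasigeodesic.  At each new vertex the previous segment determines the direction back to the starting point, so
the backtracking never exceeds \<open>c + \<delta>\<close> seen from the start, and each segment gains at least \<open>1\<close> in
distance.  Running the argument in both directions costs another \<open>\<delta>\<close>.\<close>

lemma homogeneous_local_to_global:
  fixes Z :: "int \<Rightarrow> 's"
  assumes hom: "homogeneous Z"
    and c: "gromov_product (Z 0) (Z (-1)) (Z 1) \<le> c"
    and long: "2 * c + 3 * \<delta> + 1 \<le> dist (Z 0) (Z 1)"
  shows "straight (c + 2 * \<delta>) Z" "real_of_int \<bar>i - j\<bar> \<le> dist (Z i) (Z j)"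
proof -
  have fwd: "gromov_product (Y 0) (Y (-1)) (Y (int n)) \<le> c + \<delta>"
    if Y: "homogeneous Y" "gromov_product (Y 0) (Y (-1)) (Y 1) \<le> c"
      "2 * c + 3 * \<delta> + 1 \<le> dist (Y 0) (Y 1)" for Y :: "int \<Rightarrow> 's" and n
  proof (induction n)
    case 0
    have "0 \<le> c" using Y(2) gromov_product_nonneg order_trans by blast
    then show ?case using delta_nonneg by (simp add: gromov_product_def dist_commute)
  next
    case (Suc n)
    have "gromov_product (Y 1) (Y 0) (Y (int (Suc n))) \<le> c + \<delta>"
      using Suc homogeneous_gromov_product[OF Y(1), of 0 1 "-1" "int n"] by (simp add: add.commute)
    then have "c + \<delta> < gromov_product (Y 0) (Y 1) (Y (int (Suc n)))"
      using gromov_product_add_swap[of "Y 0" "Y 1" "Y (int (Suc n))"] Y(3) delta_nonneg by linarith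
    then show ?case using gromov_product_replace[OF Y(2)] by blast
  qed
  let ?R = "\<lambda>i. Z (- i)"
  have fX: "gromov_product (Z 0) (Z (-1)) (Z (int n)) \<le> c + \<delta>" for n
    using fwd[OF hom c long] .
  have fR: "gromov_product (Z 0) (Z 1) (Z (- int n)) \<le> c + \<delta>" for n
  proof -
    have "dist (Z 0) (Z (-1)) = dist (Z 0) (Z 1)"
      using homogeneous_dist_abs[OF hom, of 0 "-1"] by simp
    then show ?thesis using fwd[OF homogeneous_reverse[OF hom], of n] c long
      by (simp add: gromov_product_commute)
  qed
  have d1: "dist (Z (-1)) (Z 0) = dist (Z 0) (Z 1)"
    using homogeneous_dist[OF hom, of "-1" 1 0] by simp
  have "gromov_product (Z 0) (Z (- int m)) (Z (int n)) \<le> c + 2 * \<delta>" for m n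
  proof (cases m)
    case 0
    then show ?thesis using c gromov_product_nonneg[of "Z 0" "Z (-1)" "Z 1"] delta_nonneg
      by (simp add: gromov_product_def dist_commute)
  next
    case (Suc m')
    have "gromov_product (Z (-1)) (Z 0) (Z (- int m)) \<le> c + \<delta>"
      using fR[of m'] homogeneous_gromov_product[OF hom, of 0 "-1" 1 "- int m'"] Suc
      by (simp add: algebra_simps)
    then have "c + 2 * \<delta> < gromov_product (Z 0) (Z (-1)) (Z (- int m))"
      using gromov_product_add_swap[of "Z 0" "Z (-1)" "Z (- int m)"] long d1 delta_nonneg
      by (simp add: dist_commute)
    moreover have "gromov_product (Z 0) (Z (int n)) (Z (-1)) \<le> c + \<delta>"
      using fX[of n] by (simp add: gromov_product_commute)
    ultimately have "gromov_product (Z 0) (Z (int n)) (Z (- int m)) \<le> c + \<delta> + \<delta>"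
      using gromov_product_replace[of "Z 0" "Z (int n)" "Z (-1)" "c + \<delta>" "Z (- int m)"] by simp
    then show ?thesis by (simp add: gromov_product_commute)
  qed
  then show "straight (c + 2 * \<delta>) Z" using straight_iff[OF hom] by blast
  have grow: "real n \<le> dist (Z 0) (Z (int n))" for n
  proof (induction n)
    case (Suc n)
    have "dist (Z (-1)) (Z (int n)) = dist (Z 0) (Z (int (Suc n)))"
      using homogeneous_dist[OF hom, of "-1" 1 "int n"] by (simp add: add.commute)
    then show ?case using fX[of n] Suc long d1 delta_nonneg unfolding gromov_product_def
      by (simp add: dist_commute field_simps)
  qed simp
  show "real_of_int \<bar>i - j\<bar> \<le> dist (Z i) (Z j)"
    using grow[of "nat \<bar>j - i\<bar>"] homogeneous_dist_abs[OF hom, of i j] by simp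
qed

text \<open>A substitute for the stability of quasigeodesics, special to homogeneous sequences.  Linear growth is incompatible
with gaining only a constant at each doubling of the time, so some doubling, from \<open>P\<close> to \<open>2P\<close>, gains
at least \<open>3\<delta> + 1\<close>.  This is exactly the hypothesis of the local-to-global principle for
the subsequence of multiples of \<open>P\<close>.\<close>

lemma homogeneous_linear_growth_straight:
  fixes Z :: "int \<Rightarrow> 's"
  assumes hom: "homogeneous Z" and L: "L > 0"
    and grow: "\<And>n::nat. real n / L - C \<le> dist (Z 0) (Z (int n))"
  shows "\<exists>D. straight D Z"
proof -
  define a where "a n = dist (Z 0) (Z n)" for n
  define B where "B = 3 * \<delta> + 1"
  have "\<exists>k::nat. a (2 ^ k) + B \<le> a (2 ^ Suc k)"
  proof (rule ccontr)
    assume "\<not> ?thesis"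
    then have step: "a (2 ^ Suc k) < a (2 ^ k) + B" for k :: nat by (simp add: not_le)
    have "a (2 ^ k) \<le> a 1 + k * B" for k :: nat
    proof (induction k)
      case (Suc k)
      then show ?case using step[of k] by (simp add: algebra_simps)
    qed simp
    moreover have "2 ^ k / L - C \<le> a (2 ^ k)" for k :: nat
      using grow[of "2 ^ k"] unfolding a_def by simp
    ultimately have bound: "2 ^ k / L - C - (a 1 + k * B) \<le> 0" for k :: nat
      by (metis diff_le_0_iff_le order_trans)
    have "filterlim (\<lambda>k::nat. 2 ^ k / L - C - (a 1 + k * B)) at_top sequentially"
      using L by real_asymp
    then have "eventually (\<lambda>k::nat. 0 < 2 ^ k / L - C - (a 1 + k * B)) sequentially"
      unfolding filterlim_at_top_dense by blast
    then obtain k :: nat where "0 < 2 ^ k / L - C - (a 1 + k * B)"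
      unfolding eventually_sequentially by blast
    with bound[of k] show False by linarith
  qed
  then obtain k :: nat where k: "a (2 ^ k) + B \<le> a (2 ^ Suc k)" by blast
  define P :: int where "P = 2 ^ k"
  have P: "P > 0" unfolding P_def by simp
  define c where "c = a P - a (2 * P) / 2"
  let ?Y = "\<lambda>i. Z (P * i)"
  have "dist (Z (- P)) (Z P) = a (2 * P)" "dist (Z 0) (Z (- P)) = a P"
    using homogeneous_dist_0[OF hom, of "- P" P] homogeneous_dist_abs[OF hom, of 0 "- P"] P
    unfolding a_def by simp_all
  then have "gromov_product (?Y 0) (?Y (-1)) (?Y 1) \<le> c"
    unfolding gromov_product_def c_def a_def by (simp add: field_simps)
  moreover have "2 * c + 3 * \<delta> + 1 \<le> dist (?Y 0) (?Y 1)"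
    using k unfolding c_def B_def P_def a_def by simp
  ultimately have str: "straight (c + 2 * \<delta>) ?Y"
    using homogeneous_local_to_global(1)[OF homogeneous_dilate[OF hom]] by blast
  define M where "M = Max (a ` {0..P})"
  have near: "dist (Z i) (Z (P * (i div P))) \<le> M" for i
  proof -
    have "dist (Z i) (Z (P * (i div P))) = a (i mod P)"
      using homogeneous_dist_0[OF hom, of "P * (i div P)" i] unfolding a_def
      by (simp add: dist_commute minus_mult_div_eq_mod)
    also have "\<dots> \<le> M" unfolding M_def using P
      by (intro Max_ge) (auto intro!: imageI less_imp_le pos_mod_bound)
    finally show ?thesis .
  qed
  have "straight (c + 2 * \<delta> + 3 * M) Z" unfolding straight_def
  proof (intro allI impI)
    fix i j l :: int assume "i \<le> j" "j \<le> l"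
    then have "i div P \<le> j div P" "j div P \<le> l div P" using P by (simp_all add: zdiv_mono1)
    then have "gromov_product (?Y (j div P)) (?Y (i div P)) (?Y (l div P)) \<le> c + 2 * \<delta>"
      using str unfolding straight_def by blast
    then show "gromov_product (Z j) (Z i) (Z l) \<le> c + 2 * \<delta> + 3 * M"
      using gromov_product_perturb[of "Z j" "Z i" "Z l" "?Y (j div P)" "?Y (i div P)" "?Y (l div P)"]
        near[of i] near[of j] near[of l] by linarith
  qed
  then show ?thesis by blast
qed

lemma gromov_product_replace_near_both:
  fixes p x y x' y' :: 's
  assumes D: "gromov_product p x y \<le> D"
    and near: "dist x x' \<le> r" "dist y y' \<le> r"
    and far: "D + 2 * \<delta> + r < dist p x" "D + 2 * \<delta> + r < dist p y"
  shows "gromov_product p x' y' \<le> D + 2 * \<delta>"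
proof -
  have "gromov_product p x y' \<le> D + \<delta>"
    using far(2) near(2) delta_nonneg by (intro gromov_product_replace_near[OF D]) linarith
  then have "gromov_product p y' x \<le> D + \<delta>"
    by (simp add: gromov_product_commute)
  then have "gromov_product p y' x' \<le> D + \<delta> + \<delta>"
    using far(1) near(1) gromov_product_replace_near[of p y' x "D + \<delta>" x'] by simp
  then show ?thesis by (simp add: gromov_product_commute)
qed

text \<open>If the rays \<open>Y\<close> and \<open>Z\<close> have unbounded Gromov products, then, after a shift of the
parameters, they stay together for an arbitrarily long time \<open>J\<close>, at a distance that depends neither on \<open>J\<close> nor on the
distance of their origins.  Beyond some index both rays run near one geodesic from \<open>Y 0\<close>.  The indices \<open>n\<close> and \<open>j\<close>
are chosen so that \<open>Y n\<close> and \<open>Z j\<close> are almost equally far from \<open>Y 0\<close>; as both rays move with the same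
speed, this persists.\<close>

lemma straight_rays_fellow_travel:
  fixes Y Z :: "int \<Rightarrow> 's"
  assumes hom: "homogeneous Y" "homogeneous Z"
    and same: "\<And>n::nat. dist (Y 0) (Y (int n)) = dist (Z 0) (Z (int n))"
    and str: "straight D Y" "straight D Z"
    and grow: "filterlim (\<lambda>n::nat. dist (Z 0) (Z (int n))) at_top sequentially"
    and par: "\<And>K. \<exists>m n::nat. K < gromov_product (Y 0) (Y (int m)) (Z (int n))"
  shows "\<exists>n j::nat. \<forall>r\<le>J. dist (Y (int (n + r))) (Z (int (j + r)))
    \<le> dist (Z 0) (Z 1) + 4 * D + 6 * \<delta>"
proof -
  define a where "a n = dist (Z 0) (Z (int n))" for n :: nat
  define \<rho> where "\<rho> = dist (Y 0) (Z 0)"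
  have D0: "0 \<le> D" using straight_nonneg[OF str(1)] .
  have distZ: "dist (Z (int i)) (Z (int (i + r))) = a r" for i r
    using homogeneous_dist_0[OF hom(2), of "int i" "int (i + r)"] unfolding a_def by simp
  have distY: "dist (Y (int i)) (Y (int (i + r))) = a r" for i r
    using homogeneous_dist_0[OF hom(1), of "int i" "int (i + r)"] same[of r] unfolding a_def by simp
  have ex: "\<exists>n0. \<forall>n\<ge>n0. B < a n" for B
    using grow unfolding a_def filterlim_at_top_dense eventually_sequentially by blast
  \<comment> \<open>From \<open>j0\<close> on, \<open>Z 0\<close> may be replaced by \<open>Y 0\<close> as the point where the geodesic starts.\<close>
  obtain j0 where j0: "\<And>j. j \<ge> j0 \<Longrightarrow> D + \<delta> + \<rho> < a j" using ex by blast
  have nearZ: "gromov_product (Z (int j)) (Y 0) (Z (int k)) \<le> D + \<delta>"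
    if "j0 \<le> j" "j \<le> k" for j k
  proof -
    have "gromov_product (Z (int j)) (Z (int k)) (Z 0) \<le> D"
      using str(2) that(2) unfolding straight_def
      by (subst gromov_product_commute) simp
    moreover have "D + \<delta> + dist (Z 0) (Y 0) < dist (Z (int j)) (Z 0)"
      using j0[OF that(1)] unfolding a_def \<rho>_def by (simp add: dist_commute)
    ultimately show ?thesis
      using gromov_product_replace_near gromov_product_commute by metis
  qed
  obtain n where n: "dist (Y 0) (Z (int j0)) < a n" using ex by blast
  \<comment> \<open>The first \<open>j\<close> at which \<open>Z\<close> is as far from \<open>Y 0\<close> as \<open>Y n\<close>; it overshoots by at most one step.\<close>
  define P where "P j \<longleftrightarrow> j0 \<le> j \<and> a n \<le> dist (Y 0) (Z (int j))" for j
  obtain j1 where j1: "\<And>j. j \<ge> j1 \<Longrightarrow> a n + \<rho> < a j" using ex by blast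
  have "P (max j0 j1)"
    using j1[of "max j0 j1"] dist_triangle[of "Z 0" "Z (int (max j0 j1))" "Y 0"]
    unfolding P_def a_def \<rho>_def by (simp add: dist_commute)
  define j where "j = (LEAST j. P j)"
  have Pj: "P j" unfolding j_def using \<open>P (max j0 j1)\<close> by (rule LeastI)
  then have "j \<noteq> j0" using n unfolding P_def by auto
  then obtain i where i: "j = Suc i" "j0 \<le> i" using Pj unfolding P_def by (cases j) auto
  then have "\<not> P i" using not_less_Least[of i P] unfolding j_def by simp
  then have "dist (Y 0) (Z (int i)) < a n" using i(2) unfolding P_def by simp
  moreover have "dist (Z (int i)) (Z (int j)) = a 1" using distZ[of i 1] i(1) by simp
  ultimately have j_upper: "dist (Y 0) (Z (int j)) \<le> a n + a 1"
    using dist_triangle[of "Y 0" "Z (int j)" "Z (int i)"] by simp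
  have j: "j0 \<le> j" "a n \<le> dist (Y 0) (Z (int j))" using Pj unfolding P_def by auto
  \<comment> \<open>So large that a Gromov product above \<open>K\<close> forces \<open>m\<close> and \<open>n'\<close> beyond all indices in question.\<close>
  define K where "K = (\<Sum>i\<le>n + j + J. a i) + \<rho> + D + \<delta>"
  have K: "a i + \<rho> + D + \<delta> \<le> K" if "i \<le> n + j + J" for i
    using member_le_sum[of i "{..n + j + J}" a] that unfolding K_def a_def by simp
  have \<rho>0: "0 \<le> \<rho>" unfolding \<rho>_def by simp
  obtain m n' where mn: "K < gromov_product (Y 0) (Y (int m)) (Z (int n'))" using par by blast
  have "K < a m"
    using mn gromov_product_le_dist[of "Y 0" "Y (int m)" "Z (int n')"] same[of m] unfolding a_def by simp
  then have m: "n + j + J < m" using K[of m] \<rho>0 D0 delta_nonneg by (cases "m \<le> n + j + J") auto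
  have "K < a n' + \<rho>"
    using mn gromov_product_le_dist[of "Y 0" "Z (int n')" "Y (int m)"]
      dist_triangle[of "Y 0" "Z (int n')" "Z 0"]
    unfolding a_def \<rho>_def by (simp add: gromov_product_commute)
  then have n': "n + j + J < n'" using K[of n'] D0 delta_nonneg by (cases "n' \<le> n + j + J") auto
  have "dist (Y (int (n + r))) (Z (int (j + r))) \<le> dist (Z 0) (Z 1) + 4 * D + 6 * \<delta>" if r: "r \<le> J" for r
  proof -
    let ?y = "Y (int (n + r))" and ?z = "Z (int (j + r))"
    have "gromov_product ?y (Y 0) (Y (int m)) \<le> D"
      using str(1) m r unfolding straight_def by simp
    moreover have "D + \<delta> < gromov_product ?y (Y (int m)) (Z (int n'))"
      using mn K[of "n + r"] r \<rho>0 distY[of 0 "n + r"]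
        gromov_product_perturb[of "Y 0" "Y (int m)" "Z (int n')" ?y "Y (int m)" "Z (int n')"] by simp
    ultimately have y: "gromov_product ?y (Y 0) (Z (int n')) \<le> D + \<delta>"
      by (rule gromov_product_replace)
    have z: "gromov_product ?z (Y 0) (Z (int n')) \<le> D + \<delta>"
      using nearZ[of "j + r" n'] j(1) n' r by simp
    have "gromov_product (Z (int j)) (Y 0) ?z \<le> D + \<delta>" using nearZ[of j "j + r"] j(1) by simp
    then have 1: "dist (Y 0) (Z (int j)) + a r - 2 * (D + \<delta>) \<le> dist (Y 0) ?z"
      using distZ[of j r] unfolding gromov_product_def by (simp add: dist_commute field_simps)
    have 2: "dist (Y 0) ?z \<le> dist (Y 0) (Z (int j)) + a r"
      using dist_triangle[of "Y 0" ?z "Z (int j)"] distZ[of j r] by simp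
    have "gromov_product (Y (int n)) (Y 0) ?y \<le> D" using str(1) unfolding straight_def by simp
    then have 3: "a n + a r - 2 * D \<le> dist (Y 0) ?y"
      using distY[of n r] distY[of 0 n] unfolding gromov_product_def by (simp add: dist_commute field_simps)
    have 4: "dist (Y 0) ?y \<le> a n + a r"
      using dist_triangle[of "Y 0" ?y "Y (int n)"] distY[of n r] distY[of 0 n] by simp
    have "\<bar>dist (Y 0) ?y - dist (Y 0) ?z\<bar> \<le> a 1 + 2 * D + 2 * \<delta>"
      using 1 2 3 4 j(2) j_upper delta_nonneg D0 unfolding a_def by (simp add: abs_le_iff)
    then show ?thesis
      using dist_le_if_near_same_geodesic[OF y z] unfolding a_def by simp
  qed
  then show ?thesis by blast
qed

text \<open>A point near a geodesic with endpoints in \<open>A\<close> is compared with the point of that geodesic at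
the same distance from \<open>x\<close>.\<close>

lemma quasiconvex_near_point:
  fixes A :: "'s set"
  assumes geo: "geodesic_space TYPE('s)"
    and qc: "\<forall>x\<in>A. \<forall>y\<in>A. \<forall>P. geodesic_segment x y P \<longrightarrow> P \<subseteq> neighborhood \<eta> A"
    and A: "x \<in> A" "y \<in> A"
    and D: "gromov_product p x y \<le> D"
  shows "\<exists>z\<in>A. dist p z \<le> 2 * D + 2 * \<delta> + \<eta>"
proof -
  obtain P where P: "geodesic_segment x y P" using geo unfolding geodesic_space_def by blast
  have D0: "0 \<le> D" using D gromov_product_nonneg[of p x y] by linarith
  obtain q where q: "q \<in> P" "dist x q = min (dist x p) (dist x y)"
    using geodesic_segment_point_at[OF P, of "min (dist x p) (dist x y)"] by auto
  have q0: "dist x q + dist q y = dist x y" using geodesic_segment_dist[OF P q(1)] .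
  have "dist p q \<le> 2 * D + 2 * \<delta>"
  proof (cases "dist x p \<le> dist x y")
    case True
    have "gromov_product q x y \<le> D" using q0 D0 unfolding gromov_product_def by (simp add: dist_commute)
    from dist_le_if_near_same_geodesic[OF D this] show ?thesis using q(2) True by simp
  next
    case False
    then have "q = y" using q(2) q0 by simp
    then show ?thesis using D False delta_nonneg unfolding gromov_product_def
      by (simp add: dist_commute field_simps)
  qed
  moreover obtain z where "z \<in> A" "dist z q \<le> \<eta>"
    using qc A P q(1) unfolding neighborhood_def by fastforce
  ultimately show ?thesis
    using dist_triangle[of p z q] by (intro bexI[of _ z]) (auto simp: dist_commute)
qed

end


section \<open>Isometric actions and the WPD condition\<close>

sublocale isometric_action \<subseteq> group G
  by (rule group_hom.axioms(1)[OF group_hom])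

context group
begin

lemma inv_mult_cancel:
  assumes "a \<in> carrier G" "b \<in> carrier G"
  shows "inv a \<otimes> (a \<otimes> b) = b" "a \<otimes> (inv a \<otimes> b) = b"
  using assms by (simp_all flip: m_assoc)

lemma int_pow_mult_mult:
  assumes "g \<in> carrier G" "b \<in> carrier G"
  shows "g [^] (i::int) \<otimes> (g [^] (j::int) \<otimes> b) = g [^] (i + j) \<otimes> b"
  using assms by (simp add: int_pow_mult m_assoc)

lemma subgroup_int_pow:
  assumes "subgroup H G" "h \<in> H"
  shows "h [^] (i::int) \<in> H"
  using assms subgroup_int_pow_closed by blast

end

context isometric_action
begin

lemma act_mult: "g \<in> carrier G \<Longrightarrow> h \<in> carrier G \<Longrightarrow> \<phi> (g \<otimes> h) x = \<phi> g (\<phi> h x)"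
  by (simp add: composition_rule)

lemma act_one [simp]: "\<phi> \<one> x = x"
  using id_eq_one by (metis UNIV_I restrict_apply)

lemma act_inv_act: "g \<in> carrier G \<Longrightarrow> \<phi> (inv g) (\<phi> g x) = x"
  by (simp flip: act_mult)

lemma act_act_inv: "g \<in> carrier G \<Longrightarrow> \<phi> g (\<phi> (inv g) x) = x"
  by (simp flip: act_mult)

lemma gromov_product_act:
  "g \<in> carrier G \<Longrightarrow> gromov_product (\<phi> g p) (\<phi> g x) (\<phi> g y) = gromov_product p x y"
  unfolding gromov_product_def by (simp add: isometry)

lemma dist_act_shift:
  "g \<in> carrier G \<Longrightarrow> dist (\<phi> (inv g) x) y = dist x (\<phi> g y)"
  using isometry[of g "\<phi> (inv g) x" y] by (simp add: act_act_inv)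

definition power_orbit :: "'g \<Rightarrow> 's \<Rightarrow> int \<Rightarrow> 's" where
  "power_orbit g p i = \<phi> (g [^] i) p"

lemma power_orbit_0 [simp]: "power_orbit g p 0 = p"
  by (simp add: power_orbit_def)

lemma power_orbit_add:
  "g \<in> carrier G \<Longrightarrow> power_orbit g p (i + j) = \<phi> (g [^] i) (power_orbit g p j)"
  by (simp add: power_orbit_def int_pow_mult act_mult)

lemma power_orbit_homogeneous:
  assumes "g \<in> carrier G"
  shows "homogeneous (power_orbit g p)"
proof -
  have "dist (power_orbit g p (i + k)) (power_orbit g p (j + k)) = dist (power_orbit g p i) (power_orbit g p j)"
    for i j k
    using power_orbit_add[OF assms, of p k i] power_orbit_add[OF assms, of p k j] assms
    by (simp add: add.commute isometry)
  then show ?thesis unfolding homogeneous_def by blast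
qed

lemma dist_power_orbit_same:
  assumes "g \<in> carrier G"
  shows "dist (power_orbit g p i) (power_orbit g q i) = dist p q"
  using assms by (simp add: power_orbit_def isometry)

lemma dist_power_orbit_le:
  assumes g: "g \<in> carrier G"
  shows "dist (power_orbit g p i) (power_orbit g p j) \<le> dist p (\<phi> g p) * \<bar>i - j\<bar>"
proof -
  note hom = power_orbit_homogeneous[OF g]
  have "dist p (power_orbit g p (int n)) \<le> dist p (\<phi> g p) * n" for n :: nat
  proof (induction n)
    case (Suc n)
    have "dist (power_orbit g p (int n)) (power_orbit g p (int (Suc n))) = dist p (\<phi> g p)"
      using homogeneous_dist_0[OF hom, of p "int n" "int (Suc n)"] g by (simp add: power_orbit_def)
    then show ?case
      using Suc dist_triangle[of p "power_orbit g p (int (Suc n))" "power_orbit g p (int n)"]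
      by (simp add: algebra_simps)
  qed simp
  from this[of "nat \<bar>j - i\<bar>"] show ?thesis
    using homogeneous_dist_abs[OF hom, of p i j] by (simp add: abs_minus_commute)
qed

lemma loxodromic_if_linear_growth:
  assumes f: "f \<in> carrier G"
    and grow: "\<And>i j. real_of_int \<bar>i - j\<bar> \<le> dist (power_orbit f p i) (power_orbit f p j)"
  shows "loxodromic G \<phi> f"
  unfolding loxodromic_def quasi_isometric_embedding_def
proof (intro conjI allI f)
  fix q
  define L where "L = max 1 (dist q (\<phi> f q))"
  have "real_of_int \<bar>i - j\<bar> / L - 2 * dist p q \<le> dist (power_orbit f q i) (power_orbit f q j)" for i j
  proof -
    have "real_of_int \<bar>i - j\<bar> / L \<le> real_of_int \<bar>i - j\<bar>"
      unfolding L_def by (simp add: divide_le_eq mult_le_cancel_left1)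
    then show ?thesis
      using grow[of i j] dist_power_orbit_same[OF f, of p i q] dist_power_orbit_same[OF f, of p j q]
        dist_triangle[of "power_orbit f p i" "power_orbit f p j" "power_orbit f q i"]
        dist_triangle[of "power_orbit f q i" "power_orbit f p j" "power_orbit f q j"]
      by (simp add: dist_commute)
  qed
  moreover have "dist (power_orbit f q i) (power_orbit f q j) \<le> L * \<bar>i - j\<bar> + 2 * dist p q" for i j
  proof -
    have "dist q (\<phi> f q) * \<bar>i - j\<bar> \<le> L * \<bar>i - j\<bar>"
      unfolding L_def by (intro mult_right_mono) auto
    then show ?thesis using dist_power_orbit_le[OF f, of q i j] zero_le_dist[of p q] by linarith
  qed
  ultimately show "\<exists>L\<ge>1. \<exists>c\<ge>0. \<forall>i j. real_of_int \<bar>i - j\<bar> / L - c \<le> dist (\<phi> (f [^] i) q) (\<phi> (f [^] j) q) \<and>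
      dist (\<phi> (f [^] i) q) (\<phi> (f [^] j) q) \<le> L * real_of_int \<bar>i - j\<bar> + c"
    unfolding power_orbit_def by (intro exI[of _ L] conjI exI[of _ "2 * dist p q"]) (auto simp: L_def)
qed

lemma loxodromic_linear_growth:
  assumes "loxodromic G \<phi> f"
  shows "\<exists>L C. L > 0 \<and> (\<forall>n::nat. real n / L - C \<le> dist p (power_orbit f p (int n)))"
proof -
  obtain L C where L: "L \<ge> 1"
    "\<And>i j :: int. real_of_int \<bar>i - j\<bar> / L - C \<le> dist (power_orbit f p i) (power_orbit f p j)"
    using assms unfolding loxodromic_def quasi_isometric_embedding_def power_orbit_def by meson
  have "real n / L - C \<le> dist p (power_orbit f p (int n))" for n
    using L(2)[of 0 "int n"] by simp
  then show ?thesis using L(1) by (intro exI[of _ L] exI[of _ C]) auto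
qed

lemma loxodromic_orbit_unbounded:
  assumes "loxodromic G \<phi> f"
  shows "filterlim (\<lambda>n::nat. dist p (power_orbit f p (int n))) at_top sequentially"
proof -
  obtain L C where L: "L > 0" "\<And>n::nat. real n / L - C \<le> dist p (power_orbit f p (int n))"
    using loxodromic_linear_growth[OF assms] by meson
  have "filterlim (\<lambda>n::nat. real n / L - C) at_top sequentially" using L(1) by real_asymp
  then show ?thesis by (rule filterlim_at_top_mono) (use L(2) in simp)
qed

text \<open>The sets whose finiteness the WPD condition asserts, for \<open>q = g\<^sup>N(p)\<close>.\<close>

definition coarse_stabilizer :: "real \<Rightarrow> 's \<Rightarrow> 's \<Rightarrow> 'g set" where
  "coarse_stabilizer \<epsilon> p q = {u \<in> carrier G. dist (\<phi> u p) p \<le> \<epsilon> \<and> dist (\<phi> u q) q \<le> \<epsilon>}"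

lemma coarse_stabilizer_mono:
  "2 * dist p p' + \<epsilon> \<le> \<epsilon>' \<Longrightarrow> 2 * dist q q' + \<epsilon> \<le> \<epsilon>' \<Longrightarrow>
    coarse_stabilizer \<epsilon> p q \<subseteq> coarse_stabilizer \<epsilon>' p' q'"
proof
  fix u assume le: "2 * dist p p' + \<epsilon> \<le> \<epsilon>'" "2 * dist q q' + \<epsilon> \<le> \<epsilon>'"
    and u: "u \<in> coarse_stabilizer \<epsilon> p q"
  have *: "dist (\<phi> u x') x' \<le> dist (\<phi> u x) x + 2 * dist x x'" for x x'
    using isometry[of u x x'] u dist_triangle[of "\<phi> u x'" x' "\<phi> u x"] dist_triangle[of "\<phi> u x" x' x]
    unfolding coarse_stabilizer_def by (simp add: dist_commute)
  show "u \<in> coarse_stabilizer \<epsilon>' p' q'"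
    using u *[of p' p] *[of q' q] le unfolding coarse_stabilizer_def by simp
qed

text \<open>A change of the base point can be absorbed into \<open>\<epsilon>\<close>, so the WPD condition needs to be
tested at one point only.\<close>

lemma loxodromic_WPD_iff:
  "loxodromic_WPD G \<phi> f \<longleftrightarrow> loxodromic G \<phi> f \<and>
    (\<forall>\<epsilon>\<ge>0. \<exists>N::nat. finite (coarse_stabilizer \<epsilon> p (power_orbit f p (int N))))"
proof -
  have eq: "{u \<in> carrier G. dist (\<phi> u q) q \<le> \<epsilon> \<and> dist (\<phi> (u \<otimes> f [^] N) q) (\<phi> (f [^] N) q) \<le> \<epsilon>}
      = coarse_stabilizer \<epsilon> q (power_orbit f q (int N))" if "f \<in> carrier G" for q \<epsilon> and N :: nat
    unfolding coarse_stabilizer_def power_orbit_def using that by (auto simp: act_mult int_pow_int)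
  show ?thesis
  proof
    assume W: "loxodromic_WPD G \<phi> f"
    then have "f \<in> carrier G" unfolding loxodromic_WPD_def loxodromic_def by blast
    then show "loxodromic G \<phi> f \<and>
        (\<forall>\<epsilon>\<ge>0. \<exists>N::nat. finite (coarse_stabilizer \<epsilon> p (power_orbit f p (int N))))"
      using W eq unfolding loxodromic_WPD_def by simp
  next
    assume W: "loxodromic G \<phi> f \<and>
        (\<forall>\<epsilon>\<ge>0. \<exists>N::nat. finite (coarse_stabilizer \<epsilon> p (power_orbit f p (int N))))"
    then have f: "f \<in> carrier G" unfolding loxodromic_def by blast
    have "\<exists>N::nat. finite (coarse_stabilizer \<epsilon> q (power_orbit f q (int N)))" if "\<epsilon> \<ge> 0" for q \<epsilon>
    proof -
      have "0 \<le> 2 * dist q p + \<epsilon>" using that by simp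
      then obtain N :: nat where "finite (coarse_stabilizer (2 * dist q p + \<epsilon>) p (power_orbit f p (int N)))"
        using W by meson
      moreover have "coarse_stabilizer \<epsilon> q (power_orbit f q (int N))
          \<subseteq> coarse_stabilizer (2 * dist q p + \<epsilon>) p (power_orbit f p (int N))"
        by (intro coarse_stabilizer_mono) (simp_all add: dist_power_orbit_same[OF f])
      ultimately show ?thesis by (blast intro: finite_subset)
    qed
    then show "loxodromic_WPD G \<phi> f"
      unfolding loxodromic_WPD_def using W eq[OF f] by simp
  qed
qed

definition coset_near :: "'s \<Rightarrow> 'g set \<Rightarrow> real \<Rightarrow> 'g \<Rightarrow> 's \<Rightarrow> bool" where
  "coset_near s H D v p \<longleftrightarrow> (\<exists>h\<in>H. dist p (\<phi> (v \<otimes> h) s) \<le> D)"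

lemma coset_near_translate:
  assumes "g \<in> carrier G" "v \<in> carrier G" "H \<subseteq> carrier G"
  shows "coset_near s H D (inv g \<otimes> v) p \<longleftrightarrow> coset_near s H D v (\<phi> g p)"
proof -
  have "dist p (\<phi> (inv g \<otimes> v \<otimes> h) s) = dist (\<phi> g p) (\<phi> (v \<otimes> h) s)" if "h \<in> H" for h
    using assms that dist_act_shift[of g "\<phi> (v \<otimes> h) s" p]
    by (auto simp: act_mult dist_commute subset_iff m_assoc)
  then show ?thesis unfolding coset_near_def by simp
qed

text \<open>Represent a coset that is near \<open>p\<close> by an element \<open>c\<close> with \<open>c(s)\<close> near \<open>p\<close>.  If also \<open>c h(s)\<close> is near
\<open>q\<close>, then \<open>h\<close> moves \<open>s\<close> by a bounded amount, which by properness leaves finitely many \<open>h\<close>.  For a given \<open>h\<close>,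
two such representatives differ by an element that moves both \<open>p\<close> and \<open>q\<close> by at most \<open>2D\<close>.\<close>

lemma coset_near_finite:
  assumes fin: "finite (coarse_stabilizer (2 * D) p q)"
    and proper: "metrically_proper \<phi> H" and sub: "subgroup H G"
  shows "\<exists>C. finite C \<and> C \<subseteq> carrier G \<and>
    (\<forall>v\<in>carrier G. coset_near s H D v p \<longrightarrow> coset_near s H D v q \<longrightarrow> (\<exists>c\<in>C. \<exists>h\<in>H. v = c \<otimes> h))"
proof -
  note H = proper subgroup.subset[OF sub]
  note inv = subgroup.m_closed[OF sub] subgroup.m_inv_closed[OF sub]
  define T where "T h = {c \<in> carrier G. dist p (\<phi> c s) \<le> D \<and> dist q (\<phi> (c \<otimes> h) s) \<le> D}" for h
  define K where "K = {h \<in> H. dist s (\<phi> h s) \<le> dist p q + 2 * D}"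
  define C where "C = (\<Union>h\<in>K. T h)"
  have "finite {h \<in> H. dist s (\<phi> h s) \<le> max 1 (dist p q + 2 * D)}"
    using H(1) unfolding metrically_proper_def by (simp del: max.bounded_iff le_max_iff_disj)
  then have "finite K"
    by (rule rev_finite_subset) (auto simp: K_def)
  moreover have "finite (T h)" if h: "h \<in> H" for h
  proof (cases "T h = {}")
    case False
    then obtain c0 where c0: "c0 \<in> T h" by blast
    have "T h \<subseteq> (\<lambda>u. u \<otimes> c0) ` coarse_stabilizer (2 * D) p q"
    proof
      fix c assume c: "c \<in> T h"
      have car: "c \<in> carrier G" "c0 \<in> carrier G" "h \<in> carrier G" using c c0 h H(2) unfolding T_def by auto
      let ?u = "c \<otimes> inv c0"
      have u: "?u \<in> carrier G" using car by simp
      have "\<phi> ?u (\<phi> c0 x) = \<phi> c x" for x using car by (simp add: act_mult act_inv_act)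
      then have "dist (\<phi> ?u p) (\<phi> c s) \<le> D" "dist (\<phi> ?u q) (\<phi> (c \<otimes> h) s) \<le> D"
        using isometry[OF u, of p "\<phi> c0 s"] isometry[OF u, of q "\<phi> (c0 \<otimes> h) s"] c0 car
        unfolding T_def by (auto simp: act_mult)
      then have "?u \<in> coarse_stabilizer (2 * D) p q"
        using c u dist_triangle[of "\<phi> ?u p" p "\<phi> c s"] dist_triangle[of "\<phi> ?u q" q "\<phi> (c \<otimes> h) s"]
        unfolding coarse_stabilizer_def T_def by (simp add: dist_commute)
      moreover have "c = ?u \<otimes> c0" using car by (simp add: m_assoc)
      ultimately show "c \<in> (\<lambda>u. u \<otimes> c0) ` coarse_stabilizer (2 * D) p q" by blast
    qed
    then show ?thesis using fin finite_surj by blast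
  qed simp
  ultimately have "finite C" unfolding C_def K_def by simp
  moreover have "C \<subseteq> carrier G" unfolding C_def T_def by auto
  moreover have "\<exists>c\<in>C. \<exists>h\<in>H. v = c \<otimes> h"
    if v: "v \<in> carrier G" and near: "coset_near s H D v p" "coset_near s H D v q" for v
  proof -
    obtain a b where ab: "a \<in> H" "b \<in> H" "dist p (\<phi> (v \<otimes> a) s) \<le> D" "dist q (\<phi> (v \<otimes> b) s) \<le> D"
      using near unfolding coset_near_def by blast
    have car: "a \<in> carrier G" "b \<in> carrier G" using ab H(2) by auto
    let ?c = "v \<otimes> a" and ?h = "inv a \<otimes> b"
    have c: "?c \<in> carrier G" and vb: "?c \<otimes> ?h = v \<otimes> b" and h: "?h \<in> H"
      using v car ab inv by (simp_all add: m_assoc inv_mult_cancel)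
    have "dist s (\<phi> ?h s) = dist (\<phi> ?c s) (\<phi> (v \<otimes> b) s)"
      using isometry[OF c, of s "\<phi> ?h s"] vb c h H(2) by (metis act_mult subsetD)
    then have "dist s (\<phi> ?h s) \<le> dist p q + 2 * D"
      using ab(3,4) dist_triangle[of "\<phi> ?c s" "\<phi> (v \<otimes> b) s" p] dist_triangle[of p "\<phi> (v \<otimes> b) s" q]
      by (simp add: dist_commute)
    then have "?c \<in> C" unfolding C_def K_def T_def using c h vb ab by auto
    moreover have "v = ?c \<otimes> inv a" using v car by (simp add: m_assoc)
    ultimately show ?thesis using inv(2)[OF ab(1)] by blast
  qed
  ultimately show ?thesis by blast
qed

end


section \<open>Transversality from the absence of conjugate powers\<close>

lemma (in group) conj_int_pow:
  assumes "v \<in> carrier G" "a \<in> carrier G"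
  shows "(inv v \<otimes> a \<otimes> v) [^] (i::int) = inv v \<otimes> a [^] i \<otimes> v"
proof -
  have "(\<lambda>a. inv v \<otimes> a \<otimes> v) \<in> hom G G"
    using assms(1) by (intro homI) (simp_all add: m_assoc inv_mult_cancel)
  from hom_int_pow[OF this assms(2) is_group is_group] show ?thesis by simp
qed

locale hyperbolic_action = isometric_action G \<phi> + gromov_hyperbolic \<delta> "TYPE('s)"
  for G (structure) and \<phi> :: "'g \<Rightarrow> 's::metric_space \<Rightarrow> 's" and \<delta> :: real +
  assumes geodesic: "geodesic_space TYPE('s)"
begin

lemma loxodromic_straight:
  assumes "loxodromic G \<phi> f"
  shows "\<exists>D. straight D (power_orbit f p)"
proof -
  have f: "f \<in> carrier G" using assms unfolding loxodromic_def by blast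
  obtain L C where "L > 0" "\<And>n::nat. real n / L - C \<le> dist p (power_orbit f p (int n))"
    using loxodromic_linear_growth[OF assms] by meson
  then show ?thesis
    using homogeneous_linear_growth_straight[OF power_orbit_homogeneous[OF f, of p], of L C] by simp
qed

text \<open>The constant \<open>\<eta>\<close> is the same for all translates \<open>vH(s)\<close>, because \<open>v\<close> acts by isometries.\<close>

lemma convex_cocompact_near_coset:
  assumes "convex_cocompact G \<phi> H"
  shows "\<exists>\<eta>\<ge>0. \<forall>D v p. \<forall>h\<in>H. \<forall>h'\<in>H. v \<in> carrier G \<longrightarrow>
    gromov_product p (\<phi> (v \<otimes> h) s) (\<phi> (v \<otimes> h') s) \<le> D \<longrightarrow>
    coset_near s H (2 * D + 2 * \<delta> + \<eta>) v p"
proof -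
  have H: "H \<subseteq> carrier G" and "quasiconvex ((\<lambda>h. \<phi> h s) ` H)"
    using assms subgroup.subset unfolding convex_cocompact_def by blast+
  then obtain \<eta> where \<eta>: "\<eta> \<ge> 0" "\<forall>x\<in>(\<lambda>h. \<phi> h s) ` H. \<forall>y\<in>(\<lambda>h. \<phi> h s) ` H. \<forall>P.
      geodesic_segment x y P \<longrightarrow> P \<subseteq> neighborhood \<eta> ((\<lambda>h. \<phi> h s) ` H)"
    unfolding quasiconvex_def by meson
  have "coset_near s H (2 * D + 2 * \<delta> + \<eta>) v p"
    if h: "h \<in> H" "h' \<in> H" and v: "v \<in> carrier G"
      and D: "gromov_product p (\<phi> (v \<otimes> h) s) (\<phi> (v \<otimes> h') s) \<le> D" for D v p h h'
  proof -
    have "gromov_product p (\<phi> (v \<otimes> h) s) (\<phi> (v \<otimes> h') s)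
        = gromov_product (\<phi> v (\<phi> (inv v) p)) (\<phi> v (\<phi> h s)) (\<phi> v (\<phi> h' s))"
      using v h H by (simp add: act_mult act_act_inv subset_iff)
    then have "gromov_product (\<phi> (inv v) p) (\<phi> h s) (\<phi> h' s) \<le> D"
      using D gromov_product_act[OF v] by simp
    then obtain h0 where "h0 \<in> H" "dist (\<phi> (inv v) p) (\<phi> h0 s) \<le> 2 * D + 2 * \<delta> + \<eta>"
      using quasiconvex_near_point[OF geodesic \<eta>(2)] h by blast
    moreover have "dist (\<phi> (inv v) p) (\<phi> h0 s) = dist p (\<phi> (v \<otimes> h0) s)"
      using \<open>h0 \<in> H\<close> H v by (simp add: dist_act_shift act_mult subset_iff)
    ultimately show ?thesis unfolding coset_near_def by auto
  qed
  with \<eta>(1) show ?thesis by blast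
qed

text \<open>If \<open>f\<^sup>n\<close> stabilizes \<open>vH\<close>, then the orbit of \<open>v(s)\<close> under \<open>f\<^sup>n\<close> lies in \<open>vH(s)\<close> and stays at bounded distance from
the orbit of \<open>p\<close>.  Far out in both directions this distance is negligible, so
\<open>p\<close> is near a geodesic with endpoints in \<open>vH(s)\<close>.  The resulting bound depends neither on \<open>v\<close> nor on \<open>n\<close>.\<close>

lemma conjugate_power_imp_coset_near:
  assumes lox: "loxodromic G \<phi> f" and str: "straight D (power_orbit f p)"
    and H: "subgroup H G"
    and \<eta>: "\<forall>D v p. \<forall>h\<in>H. \<forall>h'\<in>H. v \<in> carrier G \<longrightarrow>
      gromov_product p (\<phi> (v \<otimes> h) s) (\<phi> (v \<otimes> h') s) \<le> D \<longrightarrow>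
      coset_near s H (2 * D + 2 * \<delta> + \<eta>) v p"
    and v: "v \<in> carrier G" and n: "0 < n" "inv v \<otimes> f [^] (n::int) \<otimes> v \<in> H"
  shows "coset_near s H (2 * (D + 2 * \<delta>) + 2 * \<delta> + \<eta>) v p"
proof -
  have f: "f \<in> carrier G" using lox unfolding loxodromic_def by blast
  let ?R = "dist p (\<phi> v s)"
  let ?h = "\<lambda>i. inv v \<otimes> f [^] (n * i) \<otimes> v"
  have h: "?h i \<in> H" for i
    using subgroup_int_pow[OF H n(2), of i] f v by (simp add: conj_int_pow int_pow_pow)
  have "\<phi> (v \<otimes> ?h i) s = \<phi> (f [^] (n * i)) (\<phi> v s)" for i
    using f v by (simp add: m_assoc inv_mult_cancel act_mult)
  then have near: "dist (power_orbit f p (n * i)) (\<phi> (v \<otimes> ?h i) s) \<le> ?R" for i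
    using f by (simp add: power_orbit_def isometry)
  obtain k0 where k0: "\<And>k::nat. k \<ge> k0 \<Longrightarrow> D + 2 * \<delta> + ?R < dist p (power_orbit f p (int k))"
    using loxodromic_orbit_unbounded[OF lox, of p]
    unfolding filterlim_at_top_dense eventually_sequentially by blast
  define k where "k = int k0"
  have nk: "0 \<le> n * k" "k \<le> n * k"
    using n(1) unfolding k_def by (simp_all add: mult_le_cancel_right1)
  then have far: "D + 2 * \<delta> + ?R < dist p (power_orbit f p (n * k))"
    using k0[of "nat (n * k)"] unfolding k_def by simp
  have "dist p (power_orbit f p (n * (- k))) = dist p (power_orbit f p (n * k))"
    using homogeneous_dist_abs[OF power_orbit_homogeneous[OF f], of p 0 "n * (- k)"] nk(1) by simp
  moreover have "gromov_product p (power_orbit f p (n * (- k))) (power_orbit f p (n * k)) \<le> D"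
    using str nk(1) unfolding straight_def
    by (metis mult_minus_right neg_le_0_iff_le power_orbit_0)
  ultimately have "gromov_product p (\<phi> (v \<otimes> ?h (- k)) s) (\<phi> (v \<otimes> ?h k) s) \<le> D + 2 * \<delta>"
    using far by (intro gromov_product_replace_near_both[OF _ near near]) auto
  then show ?thesis using \<eta> h v by blast
qed

text \<open>Between two indices at which the orbit of \<open>f\<close> is near \<open>vH(s)\<close>, all points \<open>f\<^sup>m(s)\<close> are near \<open>vH(s)\<close>, with a constant
that depends on \<open>E\<close>.  Equivalently, \<open>f\<^sup>-\<^sup>mvH\<close> is near both \<open>s\<close> and \<open>f\<^sup>N(s)\<close>, as long as \<open>m + N\<close> stays below the second
index.  Only finitely many cosets have this property, so if the indices are too far apart, then two of the cosets
\<open>f\<^sup>-\<^sup>mvH\<close> agree and a power of \<open>f\<close> lies in \<open>vHv\<^sup>-\<^sup>1\<close>.\<close>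

lemma no_conjugate_power_imp_transverse:
  assumes W: "loxodromic_WPD G \<phi> f" and H: "convex_cocompact G \<phi> H"
    and free: "\<And>v n. v \<in> carrier G \<Longrightarrow> 0 < n \<Longrightarrow> inv v \<otimes> f [^] (n::int) \<otimes> v \<notin> H"
  shows "transverse G \<phi> s f H"
  unfolding transverse_def
proof (intro allI impI)
  fix E :: real assume E: "0 \<le> E"
  have lox: "loxodromic G \<phi> f" using W unfolding loxodromic_WPD_def by blast
  have f: "f \<in> carrier G" using lox unfolding loxodromic_def by blast
  have sub: "subgroup H G" and proper: "metrically_proper \<phi> H"
    using H unfolding convex_cocompact_def by auto
  note Hc = subgroup.subset[OF sub]
  obtain D where D: "straight D (power_orbit f s)" using loxodromic_straight[OF lox] by blast
  have "0 \<le> D" using straight_nonneg[OF D] .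
  obtain \<eta> where \<eta>: "\<eta> \<ge> 0" "\<forall>D v p. \<forall>h\<in>H. \<forall>h'\<in>H. v \<in> carrier G \<longrightarrow>
      gromov_product p (\<phi> (v \<otimes> h) s) (\<phi> (v \<otimes> h') s) \<le> D \<longrightarrow>
      coset_near s H (2 * D + 2 * \<delta> + \<eta>) v p"
    using convex_cocompact_near_coset[OF H] by blast
  define D' where "D' = 2 * (D + 2 * E) + 2 * \<delta> + \<eta>"
  have "0 \<le> 2 * D'" using \<open>0 \<le> D\<close> E \<eta>(1) delta_nonneg unfolding D'_def by simp
  then obtain N :: nat where "finite (coarse_stabilizer (2 * D') s (power_orbit f s (int N)))"
    using W loxodromic_WPD_iff[of f s] by blast
  from coset_near_finite[where s = s, OF this proper sub]
  obtain C where C: "finite C" "C \<subseteq> carrier G" and near_C: "\<forall>v\<in>carrier G. coset_near s H D' v s \<longrightarrow>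
      coset_near s H D' v (power_orbit f s (int N)) \<longrightarrow> (\<exists>c\<in>C. \<exists>h\<in>H. v = c \<otimes> h)"
    by auto
  define L where "L = int N + int (card C)"
  let ?J = "\<lambda>v. {m::int. \<exists>y\<in>H. dist (\<phi> (f [^] m) s) (\<phi> (v \<otimes> y) s) \<le> E}"
  have "finite (?J v) \<and> card (?J v) \<le> nat (2 * L + 1)" if v: "v \<in> carrier G" for v
  proof -
    let ?I = "?J v"
    have gap: "m2 - m1 \<le> L" if m: "m1 \<in> ?I" "m2 \<in> ?I" for m1 m2
    proof (rule ccontr)
      assume "\<not> m2 - m1 \<le> L"
      then have long: "m1 + int (card C) + int N \<le> m2" unfolding L_def by simp
      have near: "coset_near s H D' v (power_orbit f s i)" if i: "m1 \<le> i" "i \<le> m2" for i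
      proof -
        obtain y1 y2 where y: "y1 \<in> H" "y2 \<in> H"
          "dist (power_orbit f s m1) (\<phi> (v \<otimes> y1) s) \<le> E" "dist (power_orbit f s m2) (\<phi> (v \<otimes> y2) s) \<le> E"
          using m unfolding power_orbit_def by blast
        have "gromov_product (power_orbit f s i) (power_orbit f s m1) (power_orbit f s m2) \<le> D"
          using D i unfolding straight_def by blast
        then have "gromov_product (power_orbit f s i) (\<phi> (v \<otimes> y1) s) (\<phi> (v \<otimes> y2) s) \<le> D + 2 * E"
          using y gromov_product_perturb[of "power_orbit f s i" "\<phi> (v \<otimes> y1) s" "\<phi> (v \<otimes> y2) s"
              "power_orbit f s i" "power_orbit f s m1" "power_orbit f s m2"] by (simp add: dist_commute)
        then show ?thesis using \<eta>(2) y v unfolding D'_def by blast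
      qed
      have "\<exists>c\<in>C. \<exists>h\<in>H. inv (f [^] (m1 + int j)) \<otimes> v = c \<otimes> h" if j: "j \<le> card C" for j
      proof (rule near_C[rule_format])
        show "inv (f [^] (m1 + int j)) \<otimes> v \<in> carrier G" using f v by simp
        show "coset_near s H D' (inv (f [^] (m1 + int j)) \<otimes> v) s"
          using near[of "m1 + int j"] long j f v Hc
          by (simp add: coset_near_translate power_orbit_def)
        show "coset_near s H D' (inv (f [^] (m1 + int j)) \<otimes> v) (power_orbit f s (int N))"
          using near[of "m1 + int j + int N"] long j f v Hc power_orbit_add[OF f, of s "m1 + int j" "int N"]
          by (simp add: coset_near_translate)
      qed
      then obtain c h where ch: "\<And>j. j \<le> card C \<Longrightarrow> c j \<in> C \<and> h j \<in> H \<and> inv (f [^] (m1 + int j)) \<otimes> v = c j \<otimes> h j"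
        by metis
      have "\<not> inj_on c {..card C}"
        using card_inj_on_le[of c "{..card C}" C] C(1) ch by auto
      then obtain i j where ij: "i \<le> card C" "j \<le> card C" "i < j" "c i = c j"
        unfolding inj_on_def by (metis atMost_iff linorder_neqE_nat)
      let ?i = "m1 + int i" and ?j = "m1 + int j"
      have car: "c i \<in> carrier G" "h i \<in> carrier G" "h j \<in> carrier G" using ch ij C(2) Hc by auto
      have "v = f [^] ?i \<otimes> (inv (f [^] ?i) \<otimes> v)" "v = f [^] ?j \<otimes> (inv (f [^] ?j) \<otimes> v)"
        using f v by (simp_all add: inv_mult_cancel)
      then have vi: "v = f [^] ?i \<otimes> (c i \<otimes> h i)" and vj: "v = f [^] ?j \<otimes> (c i \<otimes> h j)"
        using ch[OF ij(1)] ch[OF ij(2)] ij(4) by simp_all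
      have "f [^] (?j - ?i) \<otimes> v = f [^] ?j \<otimes> (c i \<otimes> h i)"
        using f car by (subst vi) (simp add: int_pow_mult_mult add.commute)
      also have "\<dots> = v \<otimes> (inv (h j) \<otimes> h i)"
        using f car by (subst vj) (simp add: m_assoc inv_mult_cancel)
      finally have "inv v \<otimes> f [^] (?j - ?i) \<otimes> v = inv (h j) \<otimes> h i"
        using f v car by (simp add: m_assoc inv_mult_cancel)
      also have "\<dots> \<in> H"
        using ch ij subgroup.m_closed[OF sub] subgroup.m_inv_closed[OF sub] by blast
      finally show False using free[OF v, of "?j - ?i"] ij(3) by simp
    qed
    show "finite ?I \<and> card ?I \<le> nat (2 * L + 1)"
    proof (cases "?I = {}")
      case False
      then obtain m where m: "m \<in> ?I" by blast
      have sub: "?I \<subseteq> {m - L..m + L}"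
      proof
        fix k assume "k \<in> ?I"
        then show "k \<in> {m - L..m + L}" using gap[of m k] gap[of k m] m by auto
      qed
      then have "finite ?I" "card ?I \<le> card {m - L..m + L}"
        by (rule finite_subset, simp) (rule card_mono[OF _ sub], simp)
      then show ?thesis by simp
    qed simp
  qed
  then show "\<exists>K::nat. \<forall>v\<in>carrier G. finite (?J v) \<and> card (?J v) \<le> K"
    by blast
qed

section \<open>A criterion for the WPD condition\<close>

text \<open>Finiteness of a single coarse stabilizer is enough.  An element \<open>u\<close> that moves \<open>p\<close> and \<open>f\<^sup>2\<^sup>j(p)\<close>
by at most \<open>\<epsilon>\<close> moves the points \<open>a = f\<^sup>j(p)\<close> and \<open>b = f\<^sup>j(q)\<close> in the middle to points near the same geodesic.  Such points
are determined, up to an error that depends on \<open>D\<close> and \<open>\<delta>\<close> but not on \<open>\<epsilon>\<close>, by their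
distances from \<open>p\<close>.  Sorting by the integer parts of these distances gives finitely many classes, and two elements of one
class differ by an element of the given coarse stabilizer, up to conjugation by \<open>f\<^sup>j\<close>.\<close>

lemma loxodromic_WPD_criterion:
  assumes f: "f \<in> carrier G"
    and str: "straight D (power_orbit f p)" "straight D (power_orbit f q)"
    and grow: "\<And>i j. real_of_int \<bar>i - j\<bar> \<le> dist (power_orbit f p i) (power_orbit f p j)"
    and fin: "finite (coarse_stabilizer (2 * D + 10 * \<delta> + 1) p q)"
  shows "loxodromic_WPD G \<phi> f"
proof -
  have "\<exists>N::nat. finite (coarse_stabilizer \<epsilon> p (power_orbit f p (int N)))" if \<epsilon>: "0 \<le> \<epsilon>" for \<epsilon>
  proof -
    have D0: "0 \<le> D" using straight_nonneg[OF str(1)] .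
    define R where "R = dist p q"
    have R0: "0 \<le> R" unfolding R_def by simp
    define j where "j = nat \<lceil>D + 5 * \<delta> + \<epsilon> + 4 * R\<rceil> + 1"
    have j: "D + 5 * \<delta> + \<epsilon> + 4 * R < real j" unfolding j_def by linarith
    define a b y where "a = power_orbit f p (int j)" and "b = power_orbit f q (int j)"
      and "y = power_orbit f p (int (2 * j))"
    note same = dist_power_orbit_same[OF f, of p _ q, folded R_def]
    have pa: "real j \<le> dist a p" "real j \<le> dist a y"
      using grow[of "int j" 0] grow[of "int j" "int (2 * j)"] unfolding a_def y_def by simp_all
    have ab: "dist a b = R" unfolding a_def b_def by (rule same)
    have pb: "real j - R \<le> dist b p" "real j - R \<le> dist b y"
      using pa ab dist_triangle[of a p b] dist_triangle[of a y b] by simp_all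
    let ?q = "power_orbit f q (int (2 * j))"
    have yq: "dist y ?q = R" unfolding y_def by (rule same)
    have qb: "real j - 2 * R \<le> dist b q" "real j - 2 * R \<le> dist b ?q"
      using pb dist_triangle[of b p q] dist_triangle[of b y ?q] yq unfolding R_def
      by (simp_all add: dist_commute)
    have ga: "gromov_product a p y \<le> D"
      using str(1) unfolding straight_def a_def y_def
      by (metis int_ops(1) of_nat_0_le_iff of_nat_mono power_orbit_0 le_add1 mult_2)
    have "gromov_product b q ?q \<le> D"
      using str(2) unfolding straight_def b_def
      by (metis int_ops(1) of_nat_0_le_iff of_nat_mono power_orbit_0 le_add1 mult_2)
    moreover have "D + 2 * \<delta> + R < dist b q" "D + 2 * \<delta> + R < dist b ?q"
      using qb j \<epsilon> R0 delta_nonneg by linarith+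
    ultimately have gb: "gromov_product b p y \<le> D + 2 * \<delta>"
      using yq gromov_product_replace_near_both[of b q ?q D p R y] by (simp add: R_def dist_commute)
    let ?U = "coarse_stabilizer \<epsilon> p y"
    have near: "gromov_product (\<phi> u c) p y \<le> e + 2 * \<delta>"
      if u: "u \<in> ?U" and c: "gromov_product c p y \<le> e" "e + 2 * \<delta> + \<epsilon> < dist c p" "e + 2 * \<delta> + \<epsilon> < dist c y"
      for u c e
    proof -
      have u': "u \<in> carrier G" using u unfolding coarse_stabilizer_def by blast
      have "gromov_product (\<phi> u c) (\<phi> u p) (\<phi> u y) \<le> e"
        using c(1) gromov_product_act[OF u'] by simp
      then show ?thesis
        using u c u' unfolding coarse_stabilizer_def
        by (intro gromov_product_replace_near_both[where r = \<epsilon>]) (auto simp: isometry)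
    qed
    have nearUa: "gromov_product (\<phi> u a) p y \<le> D + 2 * \<delta>" if "u \<in> ?U" for u
      using near[OF that ga] pa j R0 delta_nonneg by simp
    have nearUb: "gromov_product (\<phi> u b) p y \<le> D + 2 * \<delta> + 2 * \<delta>" if "u \<in> ?U" for u
      using near[OF that gb] pb j R0 delta_nonneg by simp
    define \<kappa> where "\<kappa> u = (\<lfloor>dist p (\<phi> u a)\<rfloor>, \<lfloor>dist p (\<phi> u b)\<rfloor>)" for u
    have "\<kappa> ` ?U \<subseteq> {0..\<lfloor>\<epsilon> + dist p a\<rfloor>} \<times> {0..\<lfloor>\<epsilon> + dist p b\<rfloor>}"
    proof safe
      fix u k l assume u: "u \<in> ?U" and kl: "(k, l) = \<kappa> u"
      have "dist p (\<phi> u c) \<le> \<epsilon> + dist p c" for c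
        using u dist_triangle[of p "\<phi> u c" "\<phi> u p"] isometry[of u p c]
        unfolding coarse_stabilizer_def by (simp add: dist_commute)
      then show "k \<in> {0..\<lfloor>\<epsilon> + dist p a\<rfloor>}" "l \<in> {0..\<lfloor>\<epsilon> + dist p b\<rfloor>}"
        using kl unfolding \<kappa>_def by (auto intro!: floor_mono)
    qed
    then have fin\<kappa>: "finite (\<kappa> ` ?U)" by (rule finite_subset) simp
    have "finite ?U"
    proof (rule ccontr)
      assume "infinite ?U"
      then obtain u0 where u0: "u0 \<in> ?U" and inf: "infinite {u \<in> ?U. \<kappa> u = \<kappa> u0}"
        using pigeonhole_infinite[OF _ fin\<kappa>] by blast
      have u0': "u0 \<in> carrier G" using u0 unfolding coarse_stabilizer_def by blast
      let ?W = "coarse_stabilizer (2 * D + 10 * \<delta> + 1) p q"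
      let ?t = "f [^] int j"
      have t: "?t \<in> carrier G" using f by simp
      have "{u \<in> ?U. \<kappa> u = \<kappa> u0} \<subseteq> (\<lambda>w. u0 \<otimes> ?t \<otimes> w \<otimes> inv ?t) ` ?W"
      proof safe
        fix u assume u: "u \<in> ?U" "\<kappa> u = \<kappa> u0"
        have u': "u \<in> carrier G" using u unfolding coarse_stabilizer_def by blast
        let ?w = "inv ?t \<otimes> (inv u0 \<otimes> (u \<otimes> ?t))"
        have w: "?w \<in> carrier G" using t u' u0' by simp
        have fl: "\<lfloor>dist p (\<phi> u a)\<rfloor> = \<lfloor>dist p (\<phi> u0 a)\<rfloor>" "\<lfloor>dist p (\<phi> u b)\<rfloor> = \<lfloor>dist p (\<phi> u0 b)\<rfloor>"
          using u(2) unfolding \<kappa>_def by simp_all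
        have *: "\<bar>r - r'\<bar> \<le> 1" if "\<lfloor>r\<rfloor> = \<lfloor>r'\<rfloor>" for r r' :: real
          using that by linarith
        have "dist (\<phi> u a) (\<phi> u0 a) \<le> 2 * D + 10 * \<delta> + 1"
          using dist_le_if_near_same_geodesic[OF nearUa[OF u(1)] nearUa[OF u0]] *[OF fl(1)] delta_nonneg by simp
        moreover have "dist (\<phi> u b) (\<phi> u0 b) \<le> 2 * D + 10 * \<delta> + 1"
          using dist_le_if_near_same_geodesic[OF nearUb[OF u(1)] nearUb[OF u0]] *[OF fl(2)] delta_nonneg by simp
        moreover have "dist (\<phi> ?w c) c = dist (\<phi> u (\<phi> ?t c)) (\<phi> u0 (\<phi> ?t c))" for c
          using t u' u0' by (simp add: act_mult dist_act_shift)
        ultimately have "?w \<in> ?W"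
          unfolding coarse_stabilizer_def using w by (simp add: a_def b_def power_orbit_def)
        moreover have "u = u0 \<otimes> ?t \<otimes> ?w \<otimes> inv ?t"
          using t u' u0' by (simp add: m_assoc inv_mult_cancel)
        ultimately show "u \<in> (\<lambda>w. u0 \<otimes> ?t \<otimes> w \<otimes> inv ?t) ` ?W" by blast
      qed
      then show False using inf fin finite_surj by blast
    qed
    then show ?thesis unfolding y_def by blast
  qed
  then show ?thesis
    using loxodromic_if_linear_growth[OF f grow] loxodromic_WPD_iff[of f p] by blast
qed

end


context group
begin

section \<open>Coverings of groups by cosets\<close>

text \<open>The elements of \<open>T\<close> need not lie in \<open>F\<close>.  A coset \<open>Qt\<close> that meets \<open>F\<close> does so in a single coset of
\<open>F \<inter> Q\<close>, namely the one through any common point.\<close>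

lemma finite_cosets_cover_imp_finite_rcosets:
  assumes F: "subgroup F G" and Q: "subgroup Q G"
    and T: "finite T" "T \<subseteq> carrier G" "\<forall>x\<in>F. \<exists>t\<in>T. \<exists>q\<in>Q. x = q \<otimes> t"
  shows "finite (rcosets\<^bsub>G\<lparr>carrier := F\<rparr>\<^esub> (F \<inter> Q))"
proof -
  note Fc = subgroup.subset[OF F] and Qc = subgroup.subset[OF Q]
  define y where "y t = (SOME y. y \<in> F \<and> (\<exists>q\<in>Q. y = q \<otimes> t))" for t
  have "rcosets\<^bsub>G\<lparr>carrier := F\<rparr>\<^esub> (F \<inter> Q) \<subseteq> (\<lambda>t. (F \<inter> Q) #> y t) ` T"
  proof
    fix U assume "U \<in> rcosets\<^bsub>G\<lparr>carrier := F\<rparr>\<^esub> (F \<inter> Q)"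
    then obtain x where x: "x \<in> F" "U = (F \<inter> Q) #> x"
      unfolding RCOSETS_def r_coset_def by auto
    then obtain t q where t: "t \<in> T" "q \<in> Q" "x = q \<otimes> t" using T(3) by blast
    then have "y t \<in> F \<and> (\<exists>q\<in>Q. y t = q \<otimes> t)"
      unfolding y_def using x(1) by (intro someI) blast
    then obtain q' where y: "y t \<in> F" "q' \<in> Q" "y t = q' \<otimes> t" by blast
    have car: "q \<in> carrier G" "q' \<in> carrier G" "t \<in> carrier G" "x \<in> carrier G" "y t \<in> carrier G"
      using t y x Fc Qc T(2) by auto
    have "x \<otimes> inv (y t) = q \<otimes> inv q'"
      using car t(3) y(3) by (simp add: m_assoc inv_mult_group inv_mult_cancel)
    moreover have "x \<otimes> inv (y t) \<in> F" "q \<otimes> inv q' \<in> Q"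
      using x(1) y(1,2) t(2) subgroup.m_closed[OF F] subgroup.m_inv_closed[OF F]
        subgroup.m_closed[OF Q] subgroup.m_inv_closed[OF Q] by blast+
    ultimately have "x \<otimes> inv (y t) \<in> F \<inter> Q" by simp
    moreover have "x = x \<otimes> inv (y t) \<otimes> y t" using car by (simp add: m_assoc)
    ultimately have "x \<in> (F \<inter> Q) #> y t" unfolding r_coset_def by blast
    moreover have "subgroup (F \<inter> Q) G" using F Q by (rule subgroups_Inter_pair)
    ultimately have "U = (F \<inter> Q) #> y t"
      using repr_independence car(5) x(2) by simp
    with t(1) show "U \<in> (\<lambda>t. (F \<inter> Q) #> y t) ` T" by blast
  qed
  then show ?thesis using T(1) finite_surj by blast
qed

text \<open>B. H. Neumann's lemma, relative to a subgroup \<open>F\<close>: if no \<open>Q \<in> \<Q>\<close> has finitely many right cosets that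
cover \<open>F\<close>, then no finite collection of right cosets of members of \<open>\<Q>\<close> covers \<open>F\<close>.  By induction on the number of
subgroups.  For a subgroup \<open>Q\<close>, some \<open>y \<in> F\<close> lies outside the given cosets of \<open>Q\<close>.  Apply the induction
hypothesis to the cosets of the other subgroups together with their translates that carry the
coset of \<open>y\<close> to the given cosets of \<open>Q\<close>.  If the element \<open>x\<close> obtained in this way lies in a given coset of
\<open>Q\<close>, then its translate in the coset of \<open>y\<close> avoids everything.\<close>

lemma neumann_coset_covering:
  assumes F: "subgroup F G" and fin: "finite \<Q>"
    and sub: "\<And>Q. Q \<in> \<Q> \<Longrightarrow> subgroup Q G"
    and inf: "\<And>Q T. Q \<in> \<Q> \<Longrightarrow> finite T \<Longrightarrow> T \<subseteq> carrier G \<Longrightarrow> \<exists>x\<in>F. \<forall>t\<in>T. \<forall>q\<in>Q. x \<noteq> q \<otimes> t"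
    and P: "finite P" "P \<subseteq> \<Q> \<times> carrier G"
  shows "\<exists>x\<in>F. \<forall>(Q, t)\<in>P. \<forall>q\<in>Q. x \<noteq> q \<otimes> t"
  using fin sub inf P
proof (induction \<Q> arbitrary: P rule: finite_induct)
  case empty
  then show ?case using subgroup.one_closed[OF F] by auto
next
  case (insert Q \<Q>)
  note Fc = subgroup.subset[OF F]
  have Q: "subgroup Q G" using insert.prems(1) by blast
  note Qc = subgroup.subset[OF Q]
  define T where "T = snd ` {p \<in> P. fst p = Q}"
  have T: "finite T" "T \<subseteq> carrier G" using insert.prems(3,4) unfolding T_def by auto
  obtain y where y: "y \<in> F" "\<forall>t\<in>T. \<forall>q\<in>Q. y \<noteq> q \<otimes> t"
    using insert.prems(2)[OF insertI1 T] by blast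
  \<comment> \<open>Representatives in \<open>F\<close> of those cosets of \<open>Q\<close> that meet \<open>F\<close>.\<close>
  define z where "z t = (SOME z. z \<in> F \<and> (\<exists>q\<in>Q. z = q \<otimes> t))" for t
  define T' where "T' = {t \<in> T. \<exists>z\<in>F. \<exists>q\<in>Q. z = q \<otimes> t}"
  have z: "z t \<in> F \<and> (\<exists>q\<in>Q. z t = q \<otimes> t)" if "t \<in> T'" for t
  proof -
    have "\<exists>z. z \<in> F \<and> (\<exists>q\<in>Q. z = q \<otimes> t)" using that unfolding T'_def by blast
    from someI_ex[OF this] show ?thesis unfolding z_def .
  qed
  define P0 where "P0 = {p \<in> P. fst p \<noteq> Q}"
  define P' where "P' = P0 \<union> (\<lambda>((Q', t'), t). (Q', t' \<otimes> inv y \<otimes> z t)) ` (P0 \<times> T')"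
  have P0: "finite P0" "P0 \<subseteq> \<Q> \<times> carrier G" using insert.prems(3,4) unfolding P0_def by auto
  have "finite P'" unfolding P'_def T'_def using P0(1) T(1) by simp
  moreover have "P' \<subseteq> \<Q> \<times> carrier G"
  proof -
    have "t' \<otimes> inv y \<otimes> z t \<in> carrier G" if "t' \<in> carrier G" "t \<in> T'" for t t'
      using that z[OF that(2)] y(1) Fc by (simp add: subset_iff)
    then show ?thesis unfolding P'_def using P0(2) by auto
  qed
  ultimately have "\<exists>x\<in>F. \<forall>(Q', t)\<in>P'. \<forall>q\<in>Q'. x \<noteq> q \<otimes> t"
    by (intro insert.IH) (simp_all add: insert.prems(1,2))
  then obtain x where x: "x \<in> F" and all: "\<forall>(Q', t)\<in>P'. \<forall>q\<in>Q'. x \<noteq> q \<otimes> t"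
    by blast
  have avoid': "(R, t) \<in> P' \<Longrightarrow> q \<in> R \<Longrightarrow> x \<noteq> q \<otimes> t" for R t q
    using bspec[OF all, of "(R, t)"] by simp
  have avoid: "(R, t) \<in> P0 \<Longrightarrow> q \<in> R \<Longrightarrow> x \<noteq> q \<otimes> t" for R t q
    using avoid'[of R t q] unfolding P'_def by simp
  show ?case
  proof (cases "\<exists>t\<in>T. \<exists>q\<in>Q. x = q \<otimes> t")
    case False
    have "x \<noteq> q \<otimes> t" if "(R, t) \<in> P" "q \<in> R" for R t q
    proof (cases "R = Q")
      case True
      then have "t \<in> T" using that(1) unfolding T_def by force
      then show ?thesis using False True that(2) by blast
    next
      case False
      then show ?thesis using that avoid unfolding P0_def by simp
    qed
    then show ?thesis using x by auto
  next
    case True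
    then obtain t q where t: "t \<in> T" "q \<in> Q" "x = q \<otimes> t" by blast
    then have t': "t \<in> T'" using x unfolding T'_def by blast
    then obtain q0 where q0: "z t \<in> F" "q0 \<in> Q" "z t = q0 \<otimes> t" using z by blast
    have car: "x \<in> carrier G" "y \<in> carrier G" "z t \<in> carrier G" "q \<in> carrier G" "q0 \<in> carrier G" "t \<in> carrier G"
      using x y(1) q0 Fc t Qc T(2) by auto
    let ?w = "x \<otimes> inv (z t) \<otimes> y"
    have w: "?w \<in> F"
      using x y(1) q0(1) subgroup.m_closed[OF F] subgroup.m_inv_closed[OF F] by blast
    have wq: "?w = q \<otimes> inv q0 \<otimes> y"
      using car t(3) q0(3) by (simp add: m_assoc inv_mult_group inv_mult_cancel)
    have "?w \<noteq> r \<otimes> t1" if p: "(R, t1) \<in> P" "r \<in> R" for R t1 r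
    proof
      assume eq: "?w = r \<otimes> t1"
      have t1: "t1 \<in> carrier G" "r \<in> carrier G"
        using p insert.prems(1,4) subgroup.subset by blast+
      show False
      proof (cases "R = Q")
        case True
        have "y = q0 \<otimes> inv q \<otimes> ?w" unfolding wq using car by (simp add: m_assoc inv_mult_cancel)
        also have "\<dots> = q0 \<otimes> inv q \<otimes> r \<otimes> t1" unfolding eq using car t1 by (simp add: m_assoc)
        finally have "y = (q0 \<otimes> inv q \<otimes> r) \<otimes> t1" .
        moreover have "q0 \<otimes> inv q \<otimes> r \<in> Q"
          using p(2) True q0(2) t(2) subgroup.m_closed[OF Q] subgroup.m_inv_closed[OF Q] by blast
        moreover have "t1 \<in> T" using p(1) True unfolding T_def by force
        ultimately show False using y(2) by blast
      next
        case False
        then have "(R, t1) \<in> P0" using p(1) unfolding P0_def by simp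
        then have "(R, t1 \<otimes> inv y \<otimes> z t) \<in> P'" unfolding P'_def using t' by force
        moreover have "x = r \<otimes> (t1 \<otimes> inv y \<otimes> z t)"
        proof -
          have "x = ?w \<otimes> inv y \<otimes> z t" using car by (simp add: m_assoc inv_mult_cancel)
          then show ?thesis unfolding eq using car t1 by (simp add: m_assoc)
        qed
        ultimately show False using avoid' p(2) by blast
      qed
    qed
    then show ?thesis using w by auto
  qed
qed

end

section \<open>Elements with parallel rays\<close>

lemma straight_reverse: "straight D Z \<Longrightarrow> straight D (\<lambda>i. Z (- i))"
  unfolding straight_def by (metis gromov_product_commute neg_le_iff_le)

context hyperbolic_action
begin

text \<open>Let \<open>x\<close> be an element for which \<open>x g\<^sup>n(s)\<close> and \<open>g\<^sup>-\<^sup>m(s)\<close> have unbounded Gromov products at \<open>s\<close>.  The two rays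
stay together for a long time, hence \<open>g\<^sup>n\<^sup>+\<^sup>r x g\<^sup>j\<^sup>+\<^sup>r\<close> belongs to a fixed set \<open>A\<close> for many
consecutive \<open>r\<close>; \<open>A\<close> is finite by the WPD condition and does not depend on \<open>x\<close>.  Two of these elements agree, so
\<open>g\<^sup>\<rho> x g\<^sup>\<rho> = x\<close> for some positive \<open>\<rho>\<close> that is at most the cardinality of \<open>A\<close>.  This relation moves all but the remainder of
\<open>j\<close> modulo \<open>\<rho>\<close> to the left of \<open>x\<close>, and finitely many cosets of \<open>\<langle>g\<rangle>\<close> remain.\<close>

lemma parallel_translates_finite:
  assumes W: "loxodromic_WPD G \<phi> g"
  shows "\<exists>T. finite T \<and> T \<subseteq> carrier G \<and> (\<forall>x\<in>carrier G.
    (\<forall>K. \<exists>m n::nat. K < gromov_product s (power_orbit g s (- int m)) (\<phi> x (power_orbit g s (int n))))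
      \<longrightarrow> (\<exists>i::int. \<exists>t\<in>T. x = g [^] i \<otimes> t))"
proof -
  have lox: "loxodromic G \<phi> g" using W unfolding loxodromic_WPD_def by blast
  have g: "g \<in> carrier G" using lox unfolding loxodromic_def by blast
  obtain D where D: "straight D (power_orbit g s)" using loxodromic_straight[OF lox] by blast
  have "0 \<le> D" using straight_nonneg[OF D] .
  define e where "e = dist s (\<phi> g s) + 4 * D + 6 * \<delta>"
  have "0 \<le> 2 * e" using \<open>0 \<le> D\<close> delta_nonneg unfolding e_def by simp
  then obtain N :: nat where fin: "finite (coarse_stabilizer (2 * e) s (power_orbit g s (int N)))"
    using W loxodromic_WPD_iff[of g s] by blast
  define A where "A = {a \<in> carrier G. dist (\<phi> a s) s \<le> e \<and>
    dist (\<phi> a (power_orbit g s (int N))) (power_orbit g s (- int N)) \<le> e}"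
  have finA: "finite A"
  proof (cases "A = {}")
    case False
    then obtain a0 where a0: "a0 \<in> A" by blast
    have "A \<subseteq> (\<lambda>u. a0 \<otimes> u) ` coarse_stabilizer (2 * e) s (power_orbit g s (int N))"
    proof
      fix a assume a: "a \<in> A"
      have car: "a \<in> carrier G" "a0 \<in> carrier G" using a a0 unfolding A_def by auto
      have "dist (\<phi> (inv a0 \<otimes> a) x) x = dist (\<phi> a x) (\<phi> a0 x)" for x
        using car by (simp add: act_mult dist_act_shift)
      then have "inv a0 \<otimes> a \<in> coarse_stabilizer (2 * e) s (power_orbit g s (int N))"
        using a a0 car dist_triangle[of "\<phi> a s" "\<phi> a0 s" s]
          dist_triangle[of "\<phi> a (power_orbit g s (int N))" "\<phi> a0 (power_orbit g s (int N))" "power_orbit g s (- int N)"]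
        unfolding coarse_stabilizer_def A_def by (simp add: dist_commute)
      moreover have "a = a0 \<otimes> (inv a0 \<otimes> a)" using car by (simp add: inv_mult_cancel)
      ultimately show "a \<in> (\<lambda>u. a0 \<otimes> u) ` coarse_stabilizer (2 * e) s (power_orbit g s (int N))" by blast
    qed
    then show ?thesis using fin finite_surj by blast
  qed simp
  define J where "J = card A"
  define T where "T = (\<lambda>(a, r). a \<otimes> g [^] (- int r)) ` (A \<times> {..J})"
  have "finite T" "T \<subseteq> carrier G" unfolding T_def using finA g by (auto simp: A_def)
  moreover have "\<exists>i::int. \<exists>t\<in>T. x = g [^] i \<otimes> t"
    if x: "x \<in> carrier G" and par: "\<forall>K. \<exists>m n::nat. K < gromov_product s (power_orbit g s (- int m)) (\<phi> x (power_orbit g s (int n)))" for x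
  proof -
    define Y where "Y i = power_orbit g s (- i)" for i
    define Z where "Z i = \<phi> x (power_orbit g s i)" for i
    note hom = power_orbit_homogeneous[OF g, of s]
    have homY: "homogeneous Y" unfolding Y_def using homogeneous_reverse[OF hom] .
    have homZ: "homogeneous Z"
      using hom x unfolding Z_def homogeneous_def by (simp add: isometry)
    have strY: "straight D Y" unfolding Y_def using straight_reverse[OF D] .
    have strZ: "straight D Z"
      using D x unfolding Z_def straight_def by (simp add: gromov_product_act)
    have Z0: "dist (Z 0) (Z i) = dist s (power_orbit g s i)" for i
      unfolding Z_def using x by (simp add: isometry)
    have same: "dist (Y 0) (Y (int n)) = dist (Z 0) (Z (int n))" for n
      unfolding Z0 using homogeneous_dist_abs[OF hom, of 0 "- int n"] by (simp add: Y_def)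
    have grow: "filterlim (\<lambda>n::nat. dist (Z 0) (Z (int n))) at_top sequentially"
      unfolding Z0 by (rule loxodromic_orbit_unbounded[OF lox])
    have "\<exists>m n::nat. K < gromov_product (Y 0) (Y (int m)) (Z (int n))" for K
      using par unfolding Y_def Z_def by simp
    from straight_rays_fellow_travel[OF homY homZ same strY strZ grow this]
    obtain n j :: nat where nj: "\<And>r. r \<le> J + N \<Longrightarrow> dist (Y (int (n + r))) (Z (int (j + r))) \<le> dist (Z 0) (Z 1) + 4 * D + 6 * \<delta>"
      by blast
    have Z1: "dist (Z 0) (Z 1) = dist s (\<phi> g s)" unfolding Z0 using g by (simp add: power_orbit_def)
    define b where "b r = g [^] int (n + r) \<otimes> (x \<otimes> g [^] int (j + r))" for r
    have b_dist: "dist (\<phi> (b r) (power_orbit g s (int l))) (power_orbit g s (- int l))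
        = dist (Y (int (n + (r + l)))) (Z (int (j + (r + l))))" for r l
    proof -
      have "\<phi> (b r) (power_orbit g s (int l)) = \<phi> (g [^] int (n + r)) (Z (int (j + (r + l))))"
        unfolding b_def Z_def using g x by (simp add: act_mult add.assoc flip: power_orbit_add)
      moreover have "power_orbit g s (- int l) = \<phi> (g [^] int (n + r)) (Y (int (n + (r + l))))"
        unfolding Y_def using g by (simp flip: power_orbit_add)
      ultimately show ?thesis using g by (simp add: isometry dist_commute)
    qed
    have bA: "b r \<in> A" if "r \<le> J" for r
      using b_dist[of r 0] b_dist[of r N] nj[of r] nj[of "r + N"] that g x
      unfolding A_def e_def Z1 by (simp add: b_def)
    have "\<not> inj_on b {..J}"
      using card_inj_on_le[of b "{..J}" A] finA bA unfolding J_def by auto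
    then obtain r1 r2 where r: "r1 \<le> J" "r2 \<le> J" "r1 < r2" "b r1 = b r2"
      unfolding inj_on_def by (metis atMost_iff linorder_neqE_nat)
    define \<rho> where "\<rho> = r2 - r1"
    have \<rho>: "0 < \<rho>" "\<rho> \<le> J" "r2 = r1 + \<rho>" using r unfolding \<rho>_def by auto
    have xx: "g [^] (- int (n + r1)) \<otimes> b k \<otimes> g [^] (- int (j + r1)) = g [^] (int k - int r1) \<otimes> (x \<otimes> g [^] (int k - int r1))" for k
      unfolding b_def using g x by (simp add: m_assoc int_pow_mult_mult flip: int_pow_mult)
    \<comment> \<open>Taking \<open>k = r1\<close> and \<open>k = r2\<close> above yields the same left-hand side.\<close>
    have step: "g [^] int \<rho> \<otimes> (x \<otimes> g [^] int \<rho>) = x"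
      using xx[of r1] xx[of r2] r(4) \<rho>(3) g x by simp
    have iter: "g [^] int (\<rho> * q) \<otimes> (x \<otimes> g [^] int (\<rho> * q)) = x" for q
    proof (induction q)
      case (Suc q)
      have "g [^] int (\<rho> * Suc q) \<otimes> (x \<otimes> g [^] int (\<rho> * Suc q))
          = g [^] int \<rho> \<otimes> ((g [^] int (\<rho> * q) \<otimes> (x \<otimes> g [^] int (\<rho> * q))) \<otimes> g [^] int \<rho>)"
        using g x by (simp add: m_assoc int_pow_mult_mult add.commute flip: int_pow_mult)
      then show ?case using Suc step by simp
    qed (use g x in simp)
    define q where "q = j div \<rho>"
    define r0 where "r0 = j mod \<rho>"
    have "r0 < \<rho>" unfolding r0_def using \<rho>(1) by simp
    then have j: "j = \<rho> * q + r0" "r0 \<le> J"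
      using \<rho>(2) unfolding q_def r0_def by simp_all
    have "g [^] (int (\<rho> * q) - int n) \<otimes> (b 0 \<otimes> g [^] (- int r0)) = g [^] int (\<rho> * q) \<otimes> (x \<otimes> g [^] int (\<rho> * q))"
      unfolding b_def using g x j(1) by (simp add: m_assoc int_pow_mult_mult flip: int_pow_mult)
    also have "\<dots> = x" by (rule iter)
    finally have "x = g [^] (int (\<rho> * q) - int n) \<otimes> (b 0 \<otimes> g [^] (- int r0))" by simp
    moreover have "b 0 \<otimes> g [^] (- int r0) \<in> T" unfolding T_def using bA[of 0] j(2) by force
    ultimately show ?thesis by blast
  qed
  ultimately show ?thesis by blast
qed

section \<open>Concatenation of long powers\<close>

text \<open>The orbit of \<open>s\<close> under \<open>f\<close> turns at \<open>s\<close> in the middle of a long run along the orbit of \<open>g\<close>: the way back to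
\<open>f\<^sup>-\<^sup>1(s)\<close> starts along \<open>g\<^sup>-\<^sup>b(s)\<close> and the way on to \<open>f(s)\<close> along \<open>g\<^sup>a(s)\<close>.  So \<open>x\<close> influences how large \<open>A\<close>
has to be, but the backtracking at \<open>s\<close> is bounded in terms of the orbit of \<open>g\<close> only.\<close>

lemma concatenation_local_geometry:
  assumes lox: "loxodromic G \<phi> g" and str: "straight D (power_orbit g s)"
    and x: "x \<in> carrier G"
    and K: "\<And>m n::nat. gromov_product s (power_orbit g s (- int m)) (\<phi> x (power_orbit g s (int n))) \<le> K"
  shows "\<exists>A::int. \<forall>a\<ge>A. \<forall>b\<ge>A. let f = g [^] a \<otimes> x \<otimes> g [^] b in
    gromov_product s (\<phi> (inv f) s) (\<phi> f s) \<le> D + 2 * \<delta> \<and>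
    2 * (D + 2 * \<delta>) + 3 * \<delta> + 1 \<le> dist s (\<phi> f s)"
proof -
  have g: "g \<in> carrier G" using lox unfolding loxodromic_def by blast
  note hom = power_orbit_homogeneous[OF g, of s]
  have "0 \<le> D" using straight_nonneg[OF str] .
  let ?o = "power_orbit g s"
  define \<rho> where "\<rho> = dist s (\<phi> x s)"
  have "0 \<le> \<rho>" unfolding \<rho>_def by simp
  have "0 \<le> K" using K[of 0 0] gromov_product_nonneg order_trans by blast
  obtain n0 where n0: "\<And>n::nat. n \<ge> n0 \<Longrightarrow> K + \<rho> + 2 * D + 7 * \<delta> + 1 < dist s (?o (int n))"
    using loxodromic_orbit_unbounded[OF lox, of s]
    unfolding filterlim_at_top_dense eventually_sequentially by blast
  have "gromov_product s (\<phi> (inv f) s) (\<phi> f s) \<le> D + 2 * \<delta> \<and>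
      2 * (D + 2 * \<delta>) + 3 * \<delta> + 1 \<le> dist s (\<phi> f s)"
    if ab: "int n0 \<le> a" "int n0 \<le> b" and f_def: "f = g [^] a \<otimes> x \<otimes> g [^] b" for a b f
  proof -
    have ab0: "0 \<le> a" "0 \<le> b" using ab by auto
    have f: "f \<in> carrier G" unfolding f_def using g x by simp
    have far: "K + \<rho> + 2 * D + 7 * \<delta> + 1 < dist s (?o a)" "K + \<rho> + 2 * D + 7 * \<delta> + 1 < dist s (?o (- b))"
      using n0[of "nat a"] n0[of "nat b"] ab ab0 homogeneous_dist_abs[OF hom, of 0 "- b"] by simp_all
    have Kab: "gromov_product s (?o (- a)) (\<phi> x (?o b)) \<le> K" using K[of "nat a" "nat b"] ab0 by simp
    have "\<phi> f s = \<phi> (g [^] a) (\<phi> x (?o b))"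
      unfolding f_def power_orbit_def using g x by (simp add: act_mult)
    moreover have "s = \<phi> (g [^] a) (?o (- a))" using g by (simp flip: power_orbit_add)
    ultimately have "gromov_product (?o a) s (\<phi> f s) \<le> K"
      using Kab gromov_product_act[of "g [^] a" s "?o (- a)" "\<phi> x (?o b)"] g
      by (metis int_pow_closed power_orbit_def)
    then have fwd: "dist s (?o a) - K \<le> gromov_product s (?o a) (\<phi> f s)"
      using gromov_product_add_swap[of s "?o a" "\<phi> f s"] by simp
    have "inv f = g [^] (- b) \<otimes> (inv x \<otimes> g [^] (- a))"
      unfolding f_def using g x by (simp add: inv_mult_group int_pow_neg m_assoc)
    then have "\<phi> (inv f) s = \<phi> (g [^] (- b)) (\<phi> (inv x) (?o (- a)))"
      unfolding power_orbit_def using g x by (simp add: act_mult)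
    moreover have "s = \<phi> (g [^] (- b)) (?o b)" using g by (simp flip: power_orbit_add)
    ultimately have "gromov_product (?o (- b)) s (\<phi> (inv f) s) = gromov_product s (?o b) (\<phi> (inv x) (?o (- a)))"
      using gromov_product_act[of "g [^] (- b)" s "?o b" "\<phi> (inv x) (?o (- a))"] g
      by (metis int_pow_closed power_orbit_def)
    also have "\<dots> = gromov_product (\<phi> x s) (\<phi> x (?o b)) (?o (- a))"
      using gromov_product_act[OF x, of s "?o b" "\<phi> (inv x) (?o (- a))"] x by (simp add: act_act_inv)
    also have "\<dots> \<le> K + \<rho>"
      using gromov_product_perturb[of "\<phi> x s" "\<phi> x (?o b)" "?o (- a)" s "\<phi> x (?o b)" "?o (- a)"] Kab
      unfolding \<rho>_def by (simp add: gromov_product_commute dist_commute)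
    finally have bwd: "dist s (?o (- b)) - K - \<rho> \<le> gromov_product s (?o (- b)) (\<phi> (inv f) s)"
      using gromov_product_add_swap[of s "?o (- b)" "\<phi> (inv f) s"] by simp
    have "gromov_product (?o 0) (?o (- b)) (?o a) \<le> D"
      using str ab0 unfolding straight_def by (meson neg_le_0_iff_le)
    then have "gromov_product s (?o a) (?o (- b)) \<le> D" by (simp add: gromov_product_commute)
    moreover have "D + \<delta> < gromov_product s (?o (- b)) (\<phi> (inv f) s)"
      using bwd far(2) \<open>0 \<le> D\<close> delta_nonneg by linarith
    ultimately have "gromov_product s (?o a) (\<phi> (inv f) s) \<le> D + \<delta>"
      by (rule gromov_product_replace)
    then have "gromov_product s (\<phi> (inv f) s) (?o a) \<le> D + \<delta>" by (simp add: gromov_product_commute)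
    moreover have "D + \<delta> + \<delta> < gromov_product s (?o a) (\<phi> f s)"
      using fwd far(1) \<open>0 \<le> D\<close> \<open>0 \<le> \<rho>\<close> delta_nonneg by linarith
    ultimately have "gromov_product s (\<phi> (inv f) s) (\<phi> f s) \<le> D + \<delta> + \<delta>"
      by (rule gromov_product_replace)
    moreover have "2 * (D + 2 * \<delta>) + 3 * \<delta> + 1 \<le> dist s (\<phi> f s)"
      using fwd far(1) \<open>0 \<le> \<rho>\<close> gromov_product_le_dist[of s "\<phi> f s" "?o a"]
      by (simp add: gromov_product_commute)
    ultimately show ?thesis by simp
  qed
  then show ?thesis unfolding Let_def by blast
qed

text \<open>The second base point \<open>g\<^sup>N(s)\<close> amounts to replacing \<open>f\<close> by its conjugate \<open>g\<^sup>a\<^sup>-\<^sup>N x g\<^sup>b\<^sup>+\<^sup>N\<close>, which has the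
same form.\<close>

lemma concatenation_straight:
  assumes lox: "loxodromic G \<phi> g" and str: "straight D (power_orbit g s)"
    and x: "x \<in> carrier G"
    and K: "\<And>m n::nat. gromov_product s (power_orbit g s (- int m)) (\<phi> x (power_orbit g s (int n))) \<le> K"
  shows "\<exists>A::int. \<forall>a\<ge>A. \<forall>b\<ge>A. let f = g [^] a \<otimes> x \<otimes> g [^] b in
    straight (D + 4 * \<delta>) (power_orbit f s) \<and>
    straight (D + 4 * \<delta>) (power_orbit f (power_orbit g s (int N))) \<and>
    (\<forall>i j. real_of_int \<bar>i - j\<bar> \<le> dist (power_orbit f s i) (power_orbit f s j))"
proof -
  have g: "g \<in> carrier G" using lox unfolding loxodromic_def by blast
  obtain A :: int where A: "\<And>a b f. A \<le> a \<Longrightarrow> A \<le> b \<Longrightarrow> f = g [^] a \<otimes> x \<otimes> g [^] b \<Longrightarrow>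
      gromov_product s (\<phi> (inv f) s) (\<phi> f s) \<le> D + 2 * \<delta> \<and>
      2 * (D + 2 * \<delta>) + 3 * \<delta> + 1 \<le> dist s (\<phi> f s)"
    using concatenation_local_geometry[OF assms] unfolding Let_def by blast
  have global: "straight (D + 4 * \<delta>) (power_orbit f p)"
    "\<forall>i j. real_of_int \<bar>i - j\<bar> \<le> dist (power_orbit f p i) (power_orbit f p j)"
    if f: "f \<in> carrier G" and "gromov_product p (\<phi> (inv f) p) (\<phi> f p) \<le> D + 2 * \<delta>"
      "2 * (D + 2 * \<delta>) + 3 * \<delta> + 1 \<le> dist p (\<phi> f p)" for f p
  proof -
    have "power_orbit f p (-1) = \<phi> (inv f) p" "power_orbit f p 1 = \<phi> f p"
      using f by (simp_all add: power_orbit_def int_pow_neg)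
    then show "straight (D + 4 * \<delta>) (power_orbit f p)"
      "\<forall>i j. real_of_int \<bar>i - j\<bar> \<le> dist (power_orbit f p i) (power_orbit f p j)"
      using homogeneous_local_to_global[OF power_orbit_homogeneous[OF f, of p], of "D + 2 * \<delta>"] that(2,3)
      by (simp_all add: add.commute)
  qed
  have "straight (D + 4 * \<delta>) (power_orbit f s) \<and>
    straight (D + 4 * \<delta>) (power_orbit f (power_orbit g s (int N))) \<and>
    (\<forall>i j. real_of_int \<bar>i - j\<bar> \<le> dist (power_orbit f s i) (power_orbit f s j))"
    if ab: "A + int N \<le> a" "A + int N \<le> b" and f_def: "f = g [^] a \<otimes> x \<otimes> g [^] b" for a b f
  proof -
    have f: "f \<in> carrier G" unfolding f_def using g x by simp
    let ?t = "g [^] int N"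
    define f' where "f' = g [^] (a - int N) \<otimes> x \<otimes> g [^] (b + int N)"
    have f': "f' \<in> carrier G" unfolding f'_def using g x by simp
    have t: "?t \<in> carrier G" using g by simp
    have "f = ?t \<otimes> f' \<otimes> inv ?t"
      unfolding f_def f'_def using g x
      by (simp add: m_assoc int_pow_mult_mult flip: int_pow_neg int_pow_mult)
    then have "\<phi> f (\<phi> ?t s) = \<phi> ?t (\<phi> f' s)" "\<phi> (inv f) (\<phi> ?t s) = \<phi> ?t (\<phi> (inv f') s)"
      using t f' by (simp_all add: act_mult act_inv_act inv_mult_group)
    then have "gromov_product (\<phi> ?t s) (\<phi> (inv f) (\<phi> ?t s)) (\<phi> f (\<phi> ?t s)) = gromov_product s (\<phi> (inv f') s) (\<phi> f' s)"
      "dist (\<phi> ?t s) (\<phi> f (\<phi> ?t s)) = dist s (\<phi> f' s)"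
      using t by (simp_all add: gromov_product_act isometry)
    then have "straight (D + 4 * \<delta>) (power_orbit f (\<phi> ?t s))"
      using A[of "a - int N" "b + int N" f'] ab f'_def global(1)[OF f] by simp
    moreover have "A \<le> a" "A \<le> b" using ab by auto
    ultimately show ?thesis
      using global[OF f, of s] A[OF _ _ f_def] by (simp add: power_orbit_def)
  qed
  then show ?thesis unfolding Let_def by blast
qed

end


context group
begin

section \<open>Powers avoiding finitely many translates of subgroups\<close>

text \<open>The conjugate \<open>vHv\<^sup>-\<^sup>1\<close>, in the form of a membership test.\<close>

definition conjugate_set :: "'a \<Rightarrow> 'a set \<Rightarrow> 'a set" where
  "conjugate_set v H = {x \<in> carrier G. inv v \<otimes> x \<otimes> v \<in> H}"

lemma conjugate_set_subgroup:
  assumes "subgroup H G" "v \<in> carrier G"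
  shows "subgroup (conjugate_set v H) G"
proof (rule subgroupI)
  show "conjugate_set v H \<subseteq> carrier G" unfolding conjugate_set_def by blast
  show "conjugate_set v H \<noteq> {}"
  proof -
    have "\<one> \<in> conjugate_set v H"
      using assms subgroup.one_closed[OF assms(1)] unfolding conjugate_set_def by simp
    then show ?thesis by blast
  qed
next
  fix x assume x: "x \<in> conjugate_set v H"
  then have "inv (inv v \<otimes> x \<otimes> v) \<in> H"
    unfolding conjugate_set_def using subgroup.m_inv_closed[OF assms(1)] by blast
  then show "inv x \<in> conjugate_set v H"
    using x assms(2) unfolding conjugate_set_def by (simp add: inv_mult_group m_assoc)
next
  fix x y assume xy: "x \<in> conjugate_set v H" "y \<in> conjugate_set v H"
  then have "(inv v \<otimes> x \<otimes> v) \<otimes> (inv v \<otimes> y \<otimes> v) \<in> H"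
    unfolding conjugate_set_def using subgroup.m_closed[OF assms(1)] by blast
  then show "x \<otimes> y \<in> conjugate_set v H"
    using xy assms(2) unfolding conjugate_set_def by (simp add: m_assoc inv_mult_cancel)
qed

lemma conjugate_set_eq_cosets:
  assumes "H \<subseteq> carrier G" "v \<in> carrier G"
  shows "(v <# H) #> inv v = conjugate_set v H"
proof
  show "(v <# H) #> inv v \<subseteq> conjugate_set v H"
    using assms unfolding l_coset_def r_coset_def conjugate_set_def
    by (auto simp: m_assoc inv_mult_cancel subset_iff)
  show "conjugate_set v H \<subseteq> (v <# H) #> inv v"
  proof
    fix x assume x: "x \<in> conjugate_set v H"
    then have "x = v \<otimes> (inv v \<otimes> x \<otimes> v) \<otimes> inv v"
      using assms(2) unfolding conjugate_set_def by (simp add: m_assoc inv_mult_cancel)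
    then show "x \<in> (v <# H) #> inv v"
      using x unfolding l_coset_def r_coset_def conjugate_set_def by blast
  qed
qed

lemma range_int_pow_subgroup:
  assumes "g \<in> carrier G"
  shows "subgroup (range (\<lambda>i::int. g [^] i)) G"
proof (rule subgroupI)
  show "range (\<lambda>i::int. g [^] i) \<subseteq> carrier G" using assms by auto
  show "inv x \<in> range (\<lambda>i::int. g [^] i)" if "x \<in> range (\<lambda>i::int. g [^] i)" for x
    using that assms by (auto simp flip: int_pow_neg)
  show "x \<otimes> y \<in> range (\<lambda>i::int. g [^] i)"
    if "x \<in> range (\<lambda>i::int. g [^] i)" "y \<in> range (\<lambda>i::int. g [^] i)" for x y
    using that assms by (auto simp flip: int_pow_mult)
qed simp

text \<open>Try \<open>b = k!\<close> for large \<open>k\<close>.  Suppose that \<open>c\<^sup>-\<^sup>1 x g\<^sup>b c' \<in> H\<close>.  If some positive power \<open>g\<^sup>n\<close> lies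
in \<open>c'Hc'\<^sup>-\<^sup>1\<close>, then so does \<open>g\<^sup>b\<close> as soon as \<open>k \<ge> n\<close>, and \<open>c\<^sup>-\<^sup>1 x c' \<in> H\<close>, which is excluded.  If no positive
power does, then at most one value of \<open>b\<close> is bad.\<close>

lemma ex_power_avoiding_right:
  fixes A :: int
  assumes g: "g \<in> carrier G" and x: "x \<in> carrier G" and fin: "finite M"
    and M: "\<And>c c' H. (c, c', H) \<in> M \<Longrightarrow> subgroup H G \<and> c \<in> carrier G \<and> c' \<in> carrier G"
    and avoid: "\<And>c c' H. (c, c', H) \<in> M \<Longrightarrow> inv c \<otimes> x \<otimes> c' \<notin> H"
  shows "\<exists>b\<ge>A. \<forall>(c, c', H)\<in>M. inv c \<otimes> (x \<otimes> g [^] b) \<otimes> c' \<notin> H"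
proof -
  define bad where "bad m k \<longleftrightarrow> (case m of (c, c', H) \<Rightarrow> inv c \<otimes> (x \<otimes> g [^] int (fact k)) \<otimes> c' \<in> H)"
    for m and k :: nat
  have "eventually (\<lambda>k. \<not> bad m k) sequentially" if m: "m \<in> M" for m
  proof -
    obtain c c' H where m_eq: "m = (c, c', H)" by (cases m)
    then have H: "subgroup H G" and c: "c \<in> carrier G" "c' \<in> carrier G"
      using M m by auto
    have bad: "bad m k \<longleftrightarrow> inv c \<otimes> (x \<otimes> g [^] int (fact k)) \<otimes> c' \<in> H" for k
      unfolding bad_def m_eq by simp
    let ?r = "\<lambda>i::int. inv c' \<otimes> g [^] i \<otimes> c'"
    show ?thesis
    proof (cases "\<exists>n::nat. 0 < n \<and> ?r (int n) \<in> H")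
      case True
      then obtain n :: nat where n: "0 < n" "?r (int n) \<in> H" by blast
      have "\<not> bad m k" if "n \<le> k" for k
      proof
        assume b: "bad m k"
        have "n dvd fact k" using n(1) that by (intro dvd_fact) auto
        then obtain l where l: "fact k = n * l" by (auto elim: dvdE)
        have "?r (int n) [^] int l = ?r (int (fact k))"
          using g c unfolding l by (simp add: conj_int_pow int_pow_pow)
        then have r: "?r (int (fact k)) \<in> H" using subgroup_int_pow[OF H n(2), of "int l"] by simp
        have "inv c \<otimes> x \<otimes> c' = (inv c \<otimes> (x \<otimes> g [^] int (fact k)) \<otimes> c') \<otimes> inv (?r (int (fact k)))"
          using g c x by (simp add: m_assoc inv_mult_group inv_mult_cancel)
        also have "\<dots> \<in> H"
          using b r subgroup.m_closed[OF H] subgroup.m_inv_closed[OF H] unfolding bad by blast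
        finally show False using avoid m m_eq by blast
      qed
      then show ?thesis unfolding eventually_sequentially by blast
    next
      case False
      show ?thesis
      \<comment> \<open>The restriction to \<open>k \<ge> 1\<close> makes \<open>k!\<close> strictly increasing, as \<open>0! = 1!\<close>.\<close>
      proof (cases "\<exists>k\<ge>1. bad m k")
        case True
        then obtain k where k: "1 \<le> k" "bad m k" by blast
        have "\<not> bad m l" if l: "k < l" for l
        proof
          assume b: "bad m l"
          have less: "(fact k :: nat) < fact l" using l k(1) by (intro fact_less_mono_nat) auto
          have "?r (int (fact l - fact k)) = inv (inv c \<otimes> (x \<otimes> g [^] int (fact k)) \<otimes> c')
              \<otimes> (inv c \<otimes> (x \<otimes> g [^] int (fact l)) \<otimes> c')"
            using g c x less by (simp add: m_assoc inv_mult_group inv_mult_cancel int_pow_mult_mult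
                of_nat_diff flip: int_pow_neg)
          also have "\<dots> \<in> H"
            using b k(2) subgroup.m_closed[OF H] subgroup.m_inv_closed[OF H] unfolding bad by blast
          finally show False using False less by (metis zero_less_diff)
        qed
        then show ?thesis unfolding eventually_sequentially by (meson Suc_le_lessD)
      next
        case False
        then show ?thesis unfolding eventually_sequentially by blast
      qed
    qed
  qed
  then have "eventually (\<lambda>k. \<forall>m\<in>M. \<not> bad m k) sequentially"
    using fin by (simp add: eventually_ball_finite)
  moreover have "eventually (\<lambda>k. nat A \<le> k) sequentially" by (rule eventually_ge_at_top)
  ultimately have "eventually (\<lambda>k. (\<forall>m\<in>M. \<not> bad m k) \<and> nat A \<le> k) sequentially"
    by (rule eventually_conj)
  then obtain k where k: "\<forall>m\<in>M. \<not> bad m k" "nat A \<le> k"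
    unfolding eventually_sequentially by blast
  have "A \<le> int (fact k)" using k(2) fact_ge_self[of k] by linarith
  then show ?thesis using k(1) unfolding bad_def by blast
qed

lemma ex_powers_avoiding:
  fixes A :: int
  assumes g: "g \<in> carrier G" and x: "x \<in> carrier G" and fin: "finite M"
    and M: "\<And>c c' H. (c, c', H) \<in> M \<Longrightarrow> subgroup H G \<and> c \<in> carrier G \<and> c' \<in> carrier G"
    and avoid: "\<And>c c' H. (c, c', H) \<in> M \<Longrightarrow> inv c \<otimes> x \<otimes> c' \<notin> H"
  shows "\<exists>a\<ge>A. \<exists>b\<ge>A. \<forall>(c, c', H)\<in>M. inv c \<otimes> (g [^] a \<otimes> x \<otimes> g [^] b) \<otimes> c' \<notin> H"
proof -
  obtain b where b: "A \<le> b" "\<forall>(c, c', H)\<in>M. inv c \<otimes> (x \<otimes> g [^] b) \<otimes> c' \<notin> H"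
    using ex_power_avoiding_right[OF assms, of A] by blast
  let ?y = "x \<otimes> g [^] b"
  have y: "?y \<in> carrier G" using g x by simp
  \<comment> \<open>Taking inverses exchanges the two sides, so the left exponent can be found in the same way.\<close>
  let ?M = "(\<lambda>(c, c', H). (c', c, H)) ` M"
  have flip: "inv c \<otimes> u \<otimes> c' \<in> H \<longleftrightarrow> inv c' \<otimes> inv u \<otimes> c \<in> H"
    if "(c, c', H) \<in> M" "u \<in> carrier G" for c c' H u
  proof -
    have *: "subgroup H G" "c \<in> carrier G" "c' \<in> carrier G" using M that(1) by auto
    have "inv (inv c \<otimes> u \<otimes> c') = inv c' \<otimes> inv u \<otimes> c" "inv (inv c' \<otimes> inv u \<otimes> c) = inv c \<otimes> u \<otimes> c'"
      using * that(2) by (simp_all add: inv_mult_group m_assoc)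
    then show ?thesis using subgroup.m_inv_closed[OF *(1)] by metis
  qed
  have "\<exists>a\<ge>A. \<forall>(c', c, H)\<in>?M. inv c' \<otimes> (inv ?y \<otimes> inv g [^] a) \<otimes> c \<notin> H"
  proof (rule ex_power_avoiding_right)
    show "inv c' \<otimes> inv ?y \<otimes> c \<notin> H" if "(c', c, H) \<in> ?M" for c' c H
      using that b(2) flip[OF _ y] by fastforce
  qed (use g y fin M in auto)
  then obtain a where a: "A \<le> a" "\<forall>(c', c, H)\<in>?M. inv c' \<otimes> (inv ?y \<otimes> inv g [^] a) \<otimes> c \<notin> H"
    by blast
  have "inv c \<otimes> (g [^] a \<otimes> x \<otimes> g [^] b) \<otimes> c' \<notin> H" if m: "(c, c', H) \<in> M" for c c' H
  proof -
    have "inv c' \<otimes> (inv ?y \<otimes> inv g [^] a) \<otimes> c \<notin> H" using a(2) m by force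
    moreover have "inv ?y \<otimes> inv g [^] a = inv (g [^] a \<otimes> x \<otimes> g [^] b)"
      using g x by (simp add: int_pow_inv inv_mult_group m_assoc)
    ultimately show ?thesis using flip[OF m, of "g [^] a \<otimes> x \<otimes> g [^] b"] g x by simp
  qed
  then show ?thesis using a(1) b(1) by blast
qed

end

context hyperbolic_action
begin

section \<open>An element of F without powers in the conjugates\<close>

lemma coset_near_mono: "coset_near s H D v p \<Longrightarrow> D \<le> D' \<Longrightarrow> coset_near s H D' v p"
  unfolding coset_near_def by (blast intro: order_trans)

text \<open>If \<open>g\<^sup>n \<in> vHv\<^sup>-\<^sup>1\<close>, then division with remainder by \<open>n\<close> covers \<open>\<langle>g\<rangle>\<close>, and with it \<open>F\<close>, by finitely
many cosets of \<open>vHv\<^sup>-\<^sup>1\<close>.\<close>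

lemma generator_avoids_conjugates:
  assumes g: "g \<in> carrier G" and T: "finite T" "T \<subseteq> carrier G"
    and cover: "\<And>x. x \<in> F \<Longrightarrow> \<exists>i::int. \<exists>t\<in>T. x = g [^] i \<otimes> t"
    and H: "subgroup H G" and v: "v \<in> carrier G"
    and inf: "\<And>T. finite T \<Longrightarrow> T \<subseteq> carrier G \<Longrightarrow> \<exists>x\<in>F. \<forall>t\<in>T. \<forall>q\<in>conjugate_set v H. x \<noteq> q \<otimes> t"
    and n: "(0::int) < n"
  shows "inv v \<otimes> g [^] n \<otimes> v \<notin> H"
proof
  assume nH: "inv v \<otimes> g [^] n \<otimes> v \<in> H"
  let ?T = "(\<lambda>(r, t). g [^] r \<otimes> t) ` ({0..n} \<times> T)"
  have "finite ?T" "?T \<subseteq> carrier G" using T g by auto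
  then obtain x where x: "x \<in> F" "\<forall>t\<in>?T. \<forall>q\<in>conjugate_set v H. x \<noteq> q \<otimes> t"
    using inf by meson
  obtain i :: int and t where it: "t \<in> T" "x = g [^] i \<otimes> t" using cover[OF x(1)] by blast
  let ?q = "g [^] (n * (i div n))"
  have "(inv v \<otimes> g [^] n \<otimes> v) [^] (i div n) \<in> H" using subgroup_int_pow[OF H nH] .
  then have "?q \<in> conjugate_set v H"
    unfolding conjugate_set_def using g v by (simp add: conj_int_pow int_pow_pow)
  moreover have "g [^] (i mod n) \<otimes> t \<in> ?T"
    using it(1) n by (force intro: less_imp_le)
  moreover have "x = ?q \<otimes> (g [^] (i mod n) \<otimes> t)"
    unfolding it(2) using g it(1) T(2) by (simp add: int_pow_mult_mult subset_iff)
  ultimately show False using x(2) by blast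
qed

text \<open>The constants have to be chosen in this order: \<open>D\<close> for the orbit of \<open>g\<close>, \<open>E\<close> for the distance at which stabilized
translates are seen, \<open>N\<close> from the WPD condition, the sets \<open>C i\<close> of coset representatives, then \<open>x\<close>, and at last
the exponents \<open>a\<close> and \<open>b\<close>.\<close>

lemma ex_element_avoiding_conjugates:
  assumes F: "subgroup F G" and g: "g \<in> F" "loxodromic_WPD G \<phi> g"
    and I: "finite I" "\<And>i. i \<in> I \<Longrightarrow> convex_cocompact G \<phi> (H i)"
    and inf: "\<And>i v T. i \<in> I \<Longrightarrow> v \<in> carrier G \<Longrightarrow> finite T \<Longrightarrow> T \<subseteq> carrier G \<Longrightarrow>
      \<exists>x\<in>F. \<forall>t\<in>T. \<forall>q\<in>conjugate_set v (H i). x \<noteq> q \<otimes> t"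
  shows "\<exists>f\<in>F. loxodromic_WPD G \<phi> f \<and>
    (\<forall>i\<in>I. \<forall>v\<in>carrier G. \<forall>n::int. 0 < n \<longrightarrow> inv v \<otimes> f [^] n \<otimes> v \<notin> H i)"
proof (cases "\<exists>T. finite T \<and> T \<subseteq> carrier G \<and> (\<forall>x\<in>F. \<exists>i::int. \<exists>t\<in>T. x = g [^] i \<otimes> t)")
  case True
  then obtain T where T: "finite T" "T \<subseteq> carrier G" "\<And>x. x \<in> F \<Longrightarrow> \<exists>i::int. \<exists>t\<in>T. x = g [^] i \<otimes> t"
    by blast
  have "g \<in> carrier G" using g(1) subgroup.subset[OF F] by blast
  then have "inv v \<otimes> g [^] n \<otimes> v \<notin> H i" if "i \<in> I" "v \<in> carrier G" "0 < n" for i v and n :: int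
    using generator_avoids_conjugates[OF _ T _ that(2) inf[OF that(1,2)] that(3)] I(2)[OF that(1)]
    unfolding convex_cocompact_def by blast
  then show ?thesis using g by blast
next
  case not_cover: False
  have sub: "subgroup (H i) G" and Hc: "H i \<subseteq> carrier G" and proper: "metrically_proper \<phi> (H i)"
    if "i \<in> I" for i
    using I(2)[OF that] subgroup.subset unfolding convex_cocompact_def by blast+
  have lox: "loxodromic G \<phi> g" using g(2) unfolding loxodromic_WPD_def by blast
  have gc: "g \<in> carrier G" using lox unfolding loxodromic_def by blast
  fix s :: 's
  obtain D where D: "straight D (power_orbit g s)" using loxodromic_straight[OF lox] by blast
  have D0: "0 \<le> D" using straight_nonneg[OF D] .
  have "\<forall>i\<in>I. \<exists>\<eta>\<ge>0. \<forall>D v p. \<forall>h\<in>H i. \<forall>h'\<in>H i. v \<in> carrier G \<longrightarrow>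
      gromov_product p (\<phi> (v \<otimes> h) s) (\<phi> (v \<otimes> h') s) \<le> D \<longrightarrow>
      coset_near s (H i) (2 * D + 2 * \<delta> + \<eta>) v p"
    using convex_cocompact_near_coset I(2) by blast
  then obtain \<eta> where \<eta>0: "\<And>i. i \<in> I \<Longrightarrow> 0 \<le> \<eta> i" and \<eta>: "\<And>i. i \<in> I \<Longrightarrow> \<forall>D v p. \<forall>h\<in>H i. \<forall>h'\<in>H i. v \<in> carrier G \<longrightarrow>
      gromov_product p (\<phi> (v \<otimes> h) s) (\<phi> (v \<otimes> h') s) \<le> D \<longrightarrow>
      coset_near s (H i) (2 * D + 2 * \<delta> + \<eta> i) v p"
    by metis
  define E where "E = 2 * (D + 4 * \<delta> + 2 * \<delta>) + 2 * \<delta> + sum \<eta> I"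
  have E: "2 * (D + 4 * \<delta> + 2 * \<delta>) + 2 * \<delta> + \<eta> i \<le> E" if "i \<in> I" for i
    unfolding E_def using member_le_sum[OF that _ I(1), of \<eta>] \<eta>0 by simp
  \<comment> \<open>One \<open>N\<close> serves both the finiteness of the near cosets and the WPD property of \<open>f\<close>.\<close>
  define \<epsilon> where "\<epsilon> = max (2 * E) (2 * (D + 4 * \<delta>) + 10 * \<delta> + 1)"
  have "0 \<le> \<epsilon>" unfolding \<epsilon>_def using D0 delta_nonneg by simp
  then obtain N :: nat where fin: "finite (coarse_stabilizer \<epsilon> s (power_orbit g s (int N)))"
    using g(2) loxodromic_WPD_iff[of g s] by blast
  let ?q = "power_orbit g s (int N)"
  have finE: "finite (coarse_stabilizer (2 * E) s ?q)"
    and finW: "finite (coarse_stabilizer (2 * (D + 4 * \<delta>) + 10 * \<delta> + 1) s ?q)"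
    using finite_subset[OF coarse_stabilizer_mono fin] by (simp_all add: \<epsilon>_def)
  have "\<forall>i\<in>I. \<exists>C. finite C \<and> C \<subseteq> carrier G \<and> (\<forall>v\<in>carrier G. coset_near s (H i) E v s \<longrightarrow>
      coset_near s (H i) E v ?q \<longrightarrow> (\<exists>c\<in>C. \<exists>h\<in>H i. v = c \<otimes> h))"
    using coset_near_finite[OF finE proper sub] by blast
  then obtain C where C: "\<And>i. i \<in> I \<Longrightarrow> finite (C i)" "\<And>i. i \<in> I \<Longrightarrow> C i \<subseteq> carrier G"
    and near: "\<And>i v. i \<in> I \<Longrightarrow> v \<in> carrier G \<Longrightarrow> coset_near s (H i) E v s \<Longrightarrow>
      coset_near s (H i) E v ?q \<Longrightarrow> \<exists>c\<in>C i. \<exists>h\<in>H i. v = c \<otimes> h"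
    by metis
  obtain T where T: "finite T" "T \<subseteq> carrier G" and par: "\<forall>x\<in>carrier G.
    (\<forall>K. \<exists>m n::nat. K < gromov_product s (power_orbit g s (- int m)) (\<phi> x (power_orbit g s (int n))))
      \<longrightarrow> (\<exists>i::int. \<exists>t\<in>T. x = g [^] i \<otimes> t)"
    using parallel_translates_finite[OF g(2), of s] by blast
  let ?Z = "range (\<lambda>i::int. g [^] i)"
  let ?IC = "SIGMA i:I. C i"
  let ?ICC = "SIGMA i:I. C i \<times> C i"
  define \<Q> where "\<Q> = insert ?Z ((\<lambda>(i, c). conjugate_set c (H i)) ` ?IC)"
  \<comment> \<open>The set \<open>c H c'\<^sup>-\<^sup>1\<close> is the right coset of \<open>c H c\<^sup>-\<^sup>1\<close> through \<open>c c'\<^sup>-\<^sup>1\<close>.\<close>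
  define P where "P = (\<lambda>t. (?Z, t)) ` T \<union> (\<lambda>(i, c, c'). (conjugate_set c (H i), c \<otimes> inv c')) ` ?ICC"
  have \<Q>_cases: "Q = ?Z \<or> (\<exists>i\<in>I. \<exists>c\<in>carrier G. Q = conjugate_set c (H i))" if "Q \<in> \<Q>" for Q
  proof (cases "Q = ?Z")
    case False
    then have "Q \<in> (\<lambda>(i, c). conjugate_set c (H i)) ` ?IC"
      using that unfolding \<Q>_def by blast
    then obtain i c where "i \<in> I" "c \<in> C i" "Q = conjugate_set c (H i)"
      by auto
    then show ?thesis using C(2)[of i] by auto
  qed simp
  have "\<exists>x\<in>F. \<forall>(Q, t)\<in>P. \<forall>q\<in>Q. x \<noteq> q \<otimes> t"
  proof (rule neumann_coset_covering[OF F])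
    show "finite \<Q>" unfolding \<Q>_def using I(1) C(1) by simp
    show "subgroup Q G" if "Q \<in> \<Q>" for Q
      using \<Q>_cases[OF that] range_int_pow_subgroup[OF gc] conjugate_set_subgroup[OF sub] by auto
    show "\<exists>x\<in>F. \<forall>t\<in>T. \<forall>q\<in>Q. x \<noteq> q \<otimes> t" if Q: "Q \<in> \<Q>" and T: "finite T" "T \<subseteq> carrier G" for Q T
    proof (cases "Q = ?Z")
      case True
      obtain x where "x \<in> F" "\<forall>i::int. \<forall>t\<in>T. x \<noteq> g [^] i \<otimes> t"
        using not_cover T by blast
      then show ?thesis unfolding True by auto
    next
      case False
      then obtain i c where ic: "i \<in> I" "c \<in> carrier G" "Q = conjugate_set c (H i)"
        using \<Q>_cases[OF Q] by blast
      show ?thesis using inf[OF ic(1,2) T] unfolding ic(3) .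
    qed
    show "finite P" unfolding P_def using T(1) I(1) C(1) by simp
    show "P \<subseteq> \<Q> \<times> carrier G"
    proof -
      have "c \<otimes> inv c' \<in> carrier G" if "i \<in> I" "c \<in> C i" "c' \<in> C i" for i c c'
        using C(2)[OF that(1)] that(2,3) by (simp add: subset_iff)
      then show ?thesis unfolding P_def \<Q>_def using T(2) by auto
    qed
  qed
  then obtain x where x: "x \<in> F" and x_avoid: "\<forall>(Q, t)\<in>P. \<forall>q\<in>Q. x \<noteq> q \<otimes> t" by blast
  have xc: "x \<in> carrier G" using x subgroup.subset[OF F] by blast
  have "x \<noteq> g [^] i \<otimes> t" if "t \<in> T" for i :: int and t
  proof -
    have "(?Z, t) \<in> P" using that unfolding P_def by simp
    from bspec[OF x_avoid this] show ?thesis by simp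
  qed
  then obtain K where K: "\<And>m n::nat. gromov_product s (power_orbit g s (- int m)) (\<phi> x (power_orbit g s (int n))) \<le> K"
    using par xc by (meson not_less)
  have x_notin: "inv c \<otimes> x \<otimes> c' \<notin> H i" if i: "i \<in> I" "c \<in> C i" "c' \<in> C i" for i c c'
  proof
    assume h: "inv c \<otimes> x \<otimes> c' \<in> H i"
    have car: "c \<in> carrier G" "c' \<in> carrier G" using i C(2) by auto
    have "inv c \<otimes> (x \<otimes> c' \<otimes> inv c) \<otimes> c = inv c \<otimes> x \<otimes> c'"
      using car xc by (simp add: m_assoc)
    then have "x \<otimes> c' \<otimes> inv c \<in> conjugate_set c (H i)"
      unfolding conjugate_set_def using h car xc by simp
    moreover have "x = (x \<otimes> c' \<otimes> inv c) \<otimes> (c \<otimes> inv c')"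
      using car xc by (simp add: m_assoc inv_mult_cancel)
    moreover have "(conjugate_set c (H i), c \<otimes> inv c') \<in> P"
      unfolding P_def by (rule UnI2, rule image_eqI[of _ _ "(i, c, c')"]) (simp_all add: i)
    then have "\<forall>q\<in>conjugate_set c (H i). x \<noteq> q \<otimes> (c \<otimes> inv c')"
      using bspec[OF x_avoid] by blast
    ultimately show False by blast
  qed
  from concatenation_straight[OF lox D xc K, of N]
  obtain A :: int where A: "\<forall>a\<ge>A. \<forall>b\<ge>A. let f = g [^] a \<otimes> x \<otimes> g [^] b in
    straight (D + 4 * \<delta>) (power_orbit f s) \<and> straight (D + 4 * \<delta>) (power_orbit f ?q) \<and>
    (\<forall>i j. real_of_int \<bar>i - j\<bar> \<le> dist (power_orbit f s i) (power_orbit f s j))"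
    by (elim exE)
  have "\<exists>a\<ge>A. \<exists>b\<ge>A. \<forall>(c, c', H)\<in>(\<lambda>(i, c, c'). (c, c', H i)) ` ?ICC.
      inv c \<otimes> (g [^] a \<otimes> x \<otimes> g [^] b) \<otimes> c' \<notin> H"
  proof (rule ex_powers_avoiding[OF gc xc])
    show "finite ((\<lambda>(i, c, c'). (c, c', H i)) ` ?ICC)" using I(1) C(1) by simp
    fix c c' Q assume "(c, c', Q) \<in> (\<lambda>(i, c, c'). (c, c', H i)) ` ?ICC"
    then obtain i where i: "i \<in> I" "c \<in> C i" "c' \<in> C i" "Q = H i" by auto
    show "subgroup Q G \<and> c \<in> carrier G \<and> c' \<in> carrier G" using sub[OF i(1)] C(2)[OF i(1)] i(2-4) by auto
    show "inv c \<otimes> x \<otimes> c' \<notin> Q" using x_notin[OF i(1-3)] i(4) by simp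
  qed
  then obtain a b where ab: "A \<le> a" "A \<le> b" and all: "\<forall>(c, c', H)\<in>(\<lambda>(i, c, c'). (c, c', H i)) ` ?ICC.
      inv c \<otimes> (g [^] a \<otimes> x \<otimes> g [^] b) \<otimes> c' \<notin> H"
    by blast
  have ab_avoid: "inv c \<otimes> (g [^] a \<otimes> x \<otimes> g [^] b) \<otimes> c' \<notin> H i" if "i \<in> I" "c \<in> C i" "c' \<in> C i" for i c c'
  proof -
    have "(c, c', H i) \<in> (\<lambda>(i, c, c'). (c, c', H i)) ` ?ICC"
      by (rule image_eqI[of _ _ "(i, c, c')"]) (simp_all add: that)
    from bspec[OF all this] show ?thesis by simp
  qed
  define f where "f = g [^] a \<otimes> x \<otimes> g [^] b"
  have fF: "f \<in> F" unfolding f_def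
    using x g(1) subgroup_int_pow[OF F] subgroup.m_closed[OF F] by blast
  have fc: "f \<in> carrier G" using fF subgroup.subset[OF F] by blast
  have f_str: "straight (D + 4 * \<delta>) (power_orbit f s)" "straight (D + 4 * \<delta>) (power_orbit f ?q)"
    and grow: "\<And>i j. real_of_int \<bar>i - j\<bar> \<le> dist (power_orbit f s i) (power_orbit f s j)"
    using A[rule_format, OF ab] unfolding f_def Let_def by simp_all
  have W: "loxodromic_WPD G \<phi> f" by (rule loxodromic_WPD_criterion[OF fc f_str grow finW])
  then have f_lox: "loxodromic G \<phi> f" unfolding loxodromic_WPD_def by blast
  have "inv v \<otimes> f [^] n \<otimes> v \<notin> H i" if i: "i \<in> I" and v: "v \<in> carrier G" and n: "0 < n" for i v and n :: int
  proof
    assume h: "inv v \<otimes> f [^] n \<otimes> v \<in> H i"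
    have coset: "\<exists>c\<in>C i. \<exists>h\<in>H i. w = c \<otimes> h"
      if w: "w \<in> carrier G" "inv w \<otimes> f [^] n \<otimes> w \<in> H i" for w
      using coset_near_mono[OF conjugate_power_imp_coset_near[OF f_lox f_str(1) sub[OF i] \<eta>[OF i] w(1) n w(2)] E[OF i]]
        coset_near_mono[OF conjugate_power_imp_coset_near[OF f_lox f_str(2) sub[OF i] \<eta>[OF i] w(1) n w(2)] E[OF i]]
      by (rule near[OF i w(1)])
    obtain c h1 where ch: "c \<in> C i" "h1 \<in> H i" "v = c \<otimes> h1" using coset[OF v h] by blast
    \<comment> \<open>The coset of \<open>f\<^sup>-\<^sup>1v\<close> is stabilized by the same power, since \<open>f\<close> commutes with \<open>f\<^sup>n\<close>.\<close>
    have "inv (inv f \<otimes> v) \<otimes> f [^] n \<otimes> (inv f \<otimes> v) = inv v \<otimes> f [^] n \<otimes> v"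
    proof -
      have "f \<otimes> f [^] n = f [^] n \<otimes> f"
        using fc int_pow_mult[of f 1 n] int_pow_mult[of f n 1] by (simp add: add.commute)
      then have "(f \<otimes> f [^] n) \<otimes> (inv f \<otimes> v) = (f [^] n \<otimes> f) \<otimes> (inv f \<otimes> v)" by simp
      then have "f \<otimes> (f [^] n \<otimes> (inv f \<otimes> v)) = f [^] n \<otimes> v"
        using fc v by (simp add: m_assoc inv_mult_cancel)
      then show ?thesis using fc v by (simp add: inv_mult_group m_assoc)
    qed
    then obtain c' h2 where ch': "c' \<in> C i" "h2 \<in> H i" "inv f \<otimes> v = c' \<otimes> h2"
      using coset[of "inv f \<otimes> v"] fc v h by auto
    have car: "c \<in> carrier G" "c' \<in> carrier G" "h1 \<in> carrier G" "h2 \<in> carrier G"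
      using ch ch' C(2)[OF i] Hc[OF i] by auto
    have "f \<otimes> (inv f \<otimes> v) = v" using fc v by (simp add: inv_mult_cancel)
    then have "f \<otimes> (c' \<otimes> h2) = c \<otimes> h1" unfolding ch'(3) using ch(3) by simp
    then have "f \<otimes> c' \<otimes> h2 = c \<otimes> h1" using fc car by (simp add: m_assoc)
    then have "f \<otimes> c' = c \<otimes> h1 \<otimes> inv h2"
      using fc car by (simp add: inv_solve_right)
    then have "inv c \<otimes> f \<otimes> c' = h1 \<otimes> inv h2"
      using fc car by (simp add: m_assoc inv_mult_cancel)
    also have "\<dots> \<in> H i"
      using ch(2) ch'(2) subgroup.m_closed[OF sub[OF i]] subgroup.m_inv_closed[OF sub[OF i]] by simp
    finally show False using ab_avoid[OF i ch(1) ch'(1)] unfolding f_def by simp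
  qed
  then show ?thesis using fF W by auto
qed

end

theorem corollary5p8:
  fixes G :: "('g, 'b) monoid_scheme"
    and \<phi> :: "'g \<Rightarrow> 's::metric_space \<Rightarrow> 's"
    and s :: 's
    and k :: nat
    and H :: "nat \<Rightarrow> 'g set"
    and F :: "'g set"
  assumes "countable (carrier G)"
    and "geodesic_space TYPE('s)"
    and "hyperbolic_space TYPE('s)"
    and "isometric_action G \<phi>"
    and "\<And>i. i \<in> {1..k} \<Longrightarrow> convex_cocompact G \<phi> (H i)"
    and "subgroup F G"
    and "\<exists>g\<in>F. loxodromic_WPD G \<phi> g"
    and "\<And>v i. v \<in> carrier G \<Longrightarrow> i \<in> {1..k} \<Longrightarrow>
           infinite (rcosets\<^bsub>G\<lparr>carrier := F\<rparr>\<^esub> (F \<inter> ((v <#\<^bsub>G\<^esub> H i) #>\<^bsub>G\<^esub> inv\<^bsub>G\<^esub> v)))"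
  shows "\<exists>f\<in>F. loxodromic_WPD G \<phi> f \<and> (\<forall>i\<in>{1..k}. transverse G \<phi> s f (H i))"
proof -
  obtain \<delta> where "four_point_condition \<delta> TYPE('s)"
    using hyperbolic_space_imp_four_point[OF assms(2,3)] by blast
  then interpret hyperbolic_action G \<phi> \<delta>
    using assms(2,4) by (simp add: hyperbolic_action_def hyperbolic_action_axioms_def gromov_hyperbolic_def)
  obtain g where g: "g \<in> F" "loxodromic_WPD G \<phi> g" using assms(7) by blast
  have inf: "\<exists>x\<in>F. \<forall>t\<in>T. \<forall>q\<in>conjugate_set v (H i). x \<noteq> q \<otimes>\<^bsub>G\<^esub> t"
    if i: "i \<in> {1..k}" and v: "v \<in> carrier G" and T: "finite T" "T \<subseteq> carrier G" for i v T
  proof (rule ccontr)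
    assume "\<not> ?thesis"
    then have cover: "\<forall>x\<in>F. \<exists>t\<in>T. \<exists>q\<in>conjugate_set v (H i). x = q \<otimes>\<^bsub>G\<^esub> t" by blast
    have sub: "subgroup (H i) G" using assms(5)[OF i] unfolding convex_cocompact_def by blast
    show False
      using finite_cosets_cover_imp_finite_rcosets[OF assms(6) conjugate_set_subgroup[OF sub v] T cover]
        assms(8)[OF v i] conjugate_set_eq_cosets[OF subgroup.subset[OF sub] v] by simp
  qed
  have "\<exists>f\<in>F. loxodromic_WPD G \<phi> f \<and> (\<forall>i\<in>{1..k}. \<forall>v\<in>carrier G. \<forall>n::int. 0 < n \<longrightarrow>
      inv\<^bsub>G\<^esub> v \<otimes>\<^bsub>G\<^esub> f [^]\<^bsub>G\<^esub> n \<otimes>\<^bsub>G\<^esub> v \<notin> H i)"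
    by (rule ex_element_avoiding_conjugates[OF assms(6) g finite_atLeastAtMost assms(5) inf])
  then obtain f where f: "f \<in> F" "loxodromic_WPD G \<phi> f"
    and free: "\<forall>i\<in>{1..k}. \<forall>v\<in>carrier G. \<forall>n::int. 0 < n \<longrightarrow> inv\<^bsub>G\<^esub> v \<otimes>\<^bsub>G\<^esub> f [^]\<^bsub>G\<^esub> n \<otimes>\<^bsub>G\<^esub> v \<notin> H i"
    by blast
  have "transverse G \<phi> s f (H i)" if "i \<in> {1..k}" for i
    using no_conjugate_power_imp_transverse[OF f(2) assms(5)[OF that]] free that by blast
  then show ?thesis using f by blast
qed

end
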